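(* Let $0<p<\infty$, $0<q,r\le\infty$, and let $b\in SV(0,1)$ satisfy $\|t^{-1/r}b(t)\|_{r,(0,1)}=\infty$. Let $d\in SV(0,1)$, $0<U<\infty$, $0<V\le\infty$, $0<W\le\infty$. (i) If $0<U<p$, then for all $f\in\mathfrak M(0,1)$ $$\|f\|_{L_b^{(p,q,r}}\sim\big\|H^{(U,W;d)}f\big\|_{B_b^{(p,q,r}} .$$ (ii) If $p<V$, then for all $f\in\mathfrak M(0,1)$ $$\|f\|_{L_b^{(p,q,r}}\sim\big\|H_{(V,W;d)}f\big\|_{B_b^{(p,q,r}} .$$
   Context: Conventions: $1/\infty=0$. $\mathfrak M(0,1)$ is the set of complex-valued Lebesgue measurable a.e. finite functions on $(0,1)$ (identified if equal a.e.). For $0<q\le\infty$, $\|\cdot\|_{q,(a,b)}$ is the usual Lebesgue (quasi-)norm on the interval $(a,b)$ (essential supremum if $q=\infty$). $f^*(t)=\inf\{\lambda>0:\ |\{x\in(0,1):|f(x)|>\lambda\}|\le t\}$ is the non-increasing rearrangement. $F\sim G$ means $c\,G\le F\le C\,G$ with constants $0<c\le C<\infty$ independent of $f$ (both sides may be $\infty$). $SV(0,1)$: positive measurable $d$ on $(0,1)$ such that for every $\varepsilon>0$ the function $t^{\varepsilon}d(t)$ is equivalent ($\sim$, pointwise with constants) to a non-decreasing function and $t^{-\varepsilon}d(t)$ is equivalent to a non-increasing function. For measurable $g$ on $(0,1)$ (possibly with value $\infty$), $$\|g\|_{B_b^{(p,q,r}}=\Big\|t^{-\frac1r}b(t)\big\|u^{\frac1p-\frac1q}|g(u)|\big\|_{q,(0,t)}\Big\|_{r,(0,1)},$$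 and the small Lorentz space $L_b^{(p,q,r}$ is the set of $f\in\mathfrak M(0,1)$ with $\|f\|_{L_b^{(p,q,r}}:=\|f^*\|_{B_b^{(p,q,r}}<\infty$. (The unbalanced parenthesis in "$(p,q,r$" is part of the notation.) Averaging operators, for $f\in\mathfrak M(0,1)$, $t\in(0,1)$: $$(H^{(U,W;d)}f)(t)=\big(t^{1/U}d(t)\big)^{-1}\big\|v^{\frac1U-\frac1W}d(v)f^*(v)\big\|_{W,(0,t)},$$ $$(H_{(V,W;d)}f)(t)=\big(t^{1/V}d(t)\big)^{-1}\big\|v^{\frac1V-\frac1W}d(v)f^*(v)\big\|_{W,(t,1)}.$$ *)

theory Defs
  imports "HOL-Probability.Essential_Supremum"
begin

text \<open>Lebesgue exponents range over \<^typ>\<open>ennreal\<close>; reciprocals of exponents are taken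
  with the convention \<open>1 / \<infinity> = 0\<close>.\<close>

definition recip :: "ennreal \<Rightarrow> real" where
  "recip q = enn2real (inverse q)"

text \<open>Real powers on \<open>[0, \<infinity>]\<close>; only used for exponents \<open>a > 0\<close>, whence \<open>\<infinity>\<close> to the power
  \<open>a\<close> is \<open>\<infinity>\<close>.\<close>

definition ennpow :: "ennreal \<Rightarrow> real \<Rightarrow> ennreal" where
  "ennpow x a = (if x = \<infinity> then \<infinity> else ennreal (enn2real x powr a))"

definition Lnorm :: "ennreal \<Rightarrow> real \<Rightarrow> real \<Rightarrow> (real \<Rightarrow> ennreal) \<Rightarrow> ennreal" where
  "Lnorm q a b g =
     (if q = \<infinity> then esssup (lebesgue_on {a<..<b}) g
      else ennpow (\<integral>\<^sup>+x. ennpow (g x) (enn2real q) \<partial>lebesgue_on {a<..<b}) (recip q))"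

text \<open>Representatives of measurable, a.e. finite functions on \<open>(0,1)\<close>: since functions are
  identified when equal a.e., it suffices to consider everywhere finite ones. Values outside
  \<open>(0,1)\<close> are irrelevant.\<close>

definition Mfun :: "(real \<Rightarrow> complex) set" where
  "Mfun = borel_measurable (lebesgue_on {0<..<1})"

definition rearr :: "(real \<Rightarrow> complex) \<Rightarrow> real \<Rightarrow> ennreal" where
  "rearr f t = Inf {ennreal l | l. l > 0 \<and>
     emeasure lebesgue {x \<in> {0<..<1}. norm (f x) > l} \<le> ennreal t}"

definition SV :: "(real \<Rightarrow> real) set" where
  "SV = {d. d \<in> borel_measurable (lebesgue_on {0<..<1}) \<and> (\<forall>t\<in>{0<..<1}. d t > 0) \<and>
     (\<forall>\<epsilon>>0.
        (\<exists>g :: real \<Rightarrow> real. mono_on {0<..<1} g \<and>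
           (\<exists>c C. 0 < c \<and> c \<le> C \<and>
              (\<forall>t\<in>{0<..<1}. c * g t \<le> t powr \<epsilon> * d t \<and> t powr \<epsilon> * d t \<le> C * g t))) \<and>
        (\<exists>g :: real \<Rightarrow> real. antimono_on {0<..<1} g \<and>
           (\<exists>c C. 0 < c \<and> c \<le> C \<and>
              (\<forall>t\<in>{0<..<1}. c * g t \<le> t powr (-\<epsilon>) * d t \<and> t powr (-\<epsilon>) * d t \<le> C * g t))))}"

text \<open>The functional is applied to \<open>[0, \<infinity>]\<close>-valued \<open>g\<close>, which plays the role of \<open>|g|\<close>.\<close>

definition Bnorm ::
  "(real \<Rightarrow> real) \<Rightarrow> real \<Rightarrow> ennreal \<Rightarrow> ennreal \<Rightarrow> (real \<Rightarrow> ennreal) \<Rightarrow> ennreal" where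
  "Bnorm b p q r g =
     Lnorm r 0 1 (\<lambda>t. ennreal (t powr (- recip r) * b t) *
       Lnorm q 0 t (\<lambda>u. ennreal (u powr (1 / p - recip q)) * g u))"

definition small_Lorentz_norm ::
  "(real \<Rightarrow> real) \<Rightarrow> real \<Rightarrow> ennreal \<Rightarrow> ennreal \<Rightarrow> (real \<Rightarrow> complex) \<Rightarrow> ennreal" where
  "small_Lorentz_norm b p q r f = Bnorm b p q r (rearr f)"

definition H_upper ::
  "real \<Rightarrow> ennreal \<Rightarrow> (real \<Rightarrow> real) \<Rightarrow> (real \<Rightarrow> complex) \<Rightarrow> real \<Rightarrow> ennreal" where
  "H_upper U W d f t = ennreal (inverse (t powr (1 / U) * d t)) *
     Lnorm W 0 t (\<lambda>v. ennreal (v powr (1 / U - recip W) * d v) * rearr f v)"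

definition H_lower ::
  "ennreal \<Rightarrow> ennreal \<Rightarrow> (real \<Rightarrow> real) \<Rightarrow> (real \<Rightarrow> complex) \<Rightarrow> real \<Rightarrow> ennreal" where
  "H_lower V W d f t = ennreal (inverse (t powr (recip V) * d t)) *
     Lnorm W t 1 (\<lambda>v. ennreal (v powr (recip V - recip W) * d v) * rearr f v)"

definition equiv_on :: "'a set \<Rightarrow> ('a \<Rightarrow> ennreal) \<Rightarrow> ('a \<Rightarrow> ennreal) \<Rightarrow> bool" where
  "equiv_on A F G \<longleftrightarrow>
     (\<exists>c C :: real. 0 < c \<and> c \<le> C \<and> (\<forall>x\<in>A. ennreal c * G x \<le> F x \<and> F x \<le> ennreal C * G x))"

end

theory Submission
  imports Defs
begin

text \<open>All norms are taken with respect to \<open>du/u\<close>. Since \<open>f\<^sup>*\<close> is non-increasing, the value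
  \<open>v\<^sup>\<beta> f\<^sup>*(v)\<close> is dominated by the \<open>q\<close>-norm of \<open>x\<^sup>\<beta> f\<^sup>*(x)\<close> over \<open>(v/2, v)\<close>, for
  any \<open>q\<close>. Bounding \<open>v\<^sup>\<beta> f\<^sup>*(v)\<close> by its supremum therefore replaces the \<open>W\<close>-norm and the weight
  \<open>d\<close> in both averages by a \<open>q\<close>-norm with a pure power weight, \<open>\<beta>\<close> being chosen strictly between
  \<open>1/p\<close> and \<open>1/U\<close> (respectively \<open>1/V\<close>). What remains are Hardy inequalities with equal
  exponents, which are Tonelli's theorem. For the lower average the part of the integral beyond \<open>t\<close>
  cannot be controlled on \<open>(0, t)\<close>; the same supremum argument, applied to the doubling function
  \<open>N(x) = \<parallel>u\<^sup>1\<^sup>/\<^sup>p f\<^sup>*(u)\<parallel>\<close> over \<open>(0, x)\<close>, trades its \<open>q\<close>-norm for an \<open>r\<close>-norm, and a second Hardy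
  inequality with weight \<open>b\<close> concludes.\<close>

section \<open>Powers on the extended half-line and Lebesgue norms\<close>

text \<open>Equal exponents turn both sides into one double integral and cover the whole range
  \<open>(0, \<infinity>]\<close>; for \<open>q = \<infinity>\<close> Tonelli's theorem becomes the
  exchange of two almost-everywhere quantifiers. The gap between the exponent of the average and
  \<open>1 / p\<close> is spent in pieces: each piece pays for one use of slow variation or for the
  convergence of one power integral. This is where the strict inequalities enter, and it explains
  the repeatedly halved parameters. The measure \<open>du/u\<close> is invariant under dilations, so
  passing between \<open>v\<close> and \<open>v / 2\<close> costs only constants. Measurability
  mostly comes from monotonicity: of \<open>rearr f\<close>, and of each norm as a function of an
  endpoint of its interval.\<close>

lemma ennpow_ennreal: "0 \<le> x \<Longrightarrow> ennpow (ennreal x) a = ennreal (x powr a)"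
  by (simp add: ennpow_def)

lemma ennpow_top [simp]: "ennpow top a = top"
  by (simp add: ennpow_def)

lemma ennpow_0 [simp]: "ennpow 0 a = 0"
  by (simp add: ennpow_def)

lemma ennpow_pos: "x > 0 \<Longrightarrow> ennpow x a > 0"
  by (cases x) (auto simp: ennpow_def ennreal_less_zero_iff)

lemma ennpow_mono:
  assumes "x \<le> y" "0 < a"
  shows "ennpow x a \<le> ennpow y a"
  using assms by (cases x; cases y) (auto simp: ennpow_ennreal powr_mono2 ennreal_leI top_unique)

text \<open>The values \<open>0\<close> at \<open>0\<close> and \<open>top\<close> at
  \<open>top\<close> do not depend on \<open>a\<close>, and \<open>0 * top = 0\<close>; hence no
  sign condition on \<open>a\<close>.\<close>

lemma ennpow_mult: "ennpow (x * y) a = ennpow x a * ennpow y a"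
proof (cases x; cases y)
  fix r s assume "x = ennreal r" "y = ennreal s" "0 \<le> r" "0 \<le> s"
  then show ?thesis
    by (simp add: ennpow_ennreal powr_mult flip: ennreal_mult)
next
  fix r assume "x = ennreal r" "y = top" "0 \<le> r"
  then show ?thesis
    using ennpow_pos[of x a] by (cases "r = 0") (auto simp: ennreal_mult_top)
next
  fix r assume "y = ennreal r" "x = top" "0 \<le> r"
  then show ?thesis
    using ennpow_pos[of y a] by (cases "r = 0") (auto simp: ennreal_top_mult)
qed auto

lemma ennpow_ennpow: "ennpow (ennpow x a) b = ennpow x (a * b)"
  by (cases x) (auto simp: ennpow_ennreal powr_powr)

lemma ennpow_1 [simp]: "ennpow x 1 = x"
  by (cases x) (auto simp: ennpow_ennreal)

lemma ennpow_le_iff: "0 < a \<Longrightarrow> ennpow x a \<le> ennpow y a \<longleftrightarrow> x \<le> y"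
  using ennpow_mono[of x y a] ennpow_mono[of "ennpow x a" "ennpow y a" "1/a"]
  by (auto simp: ennpow_ennpow)

lemma ennpow_indicator: "ennpow (x * indicator A u) a = ennpow x a * indicator A u"
  by (simp add: indicator_def)

lemma ennpow_measurable [measurable]:
  assumes "f \<in> borel_measurable M"
  shows "(\<lambda>x. ennpow (f x) a) \<in> borel_measurable M"
  unfolding ennpow_def using assms by measurable

text \<open>Bounding a sum by twice the maximum is crude, but works for \<open>a < 1\<close> and
  \<open>a \<ge> 1\<close> alike. It is the only substitute for a triangle inequality in what
  follows.\<close>

lemma ennpow_add_le:
  assumes "0 < a"
  shows "ennpow (x + y) a \<le> ennreal (2 powr a) * (ennpow x a + ennpow y a)"
proof -
  have "x + y \<le> 2 * max x y"
    by (simp add: mult_2 add_mono)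
  then have "ennpow (x + y) a \<le> ennpow (2 * max x y) a"
    by (rule ennpow_mono) fact
  also have "\<dots> = ennreal (2 powr a) * ennpow (max x y) a"
    using ennpow_ennreal[of 2 a] by (simp add: ennpow_mult)
  also have "ennpow (max x y) a \<le> ennpow x a + ennpow y a"
    by (simp add: max_def)
  finally show ?thesis
    by (simp add: mult_left_mono)
qed

section \<open>Reciprocal exponents and norms over intervals\<close>

lemma recip_top [simp]: "recip top = 0"
  by (simp add: recip_def)

lemma recip_finite: "q \<noteq> top \<Longrightarrow> recip q = 1 / enn2real q"
  using inverse_ennreal[of "enn2real q"]
  by (cases q; cases "q = 0") (auto simp: recip_def inverse_eq_divide)

lemma recip_nonneg: "0 \<le> recip q"
  by (simp add: recip_def)

lemma Lnorm_top: "Lnorm top a b g = esssup (lebesgue_on {a<..<b}) g"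
  by (simp add: Lnorm_def)

text \<open>Over \<open>lborel\<close> with an indicator, rather than over a restricted completed
  measure, Tonelli's theorem and affine substitutions can be applied directly.\<close>

lemma Lnorm_finite:
  assumes "0 < q" "q \<noteq> top"
  shows "Lnorm q a b g =
    ennpow (\<integral>\<^sup>+x. ennpow (g x) (enn2real q) * indicator {a<..<b} x \<partial>lborel) (1 / enn2real q)"
  using assms
  by (simp add: Lnorm_def recip_finite nn_integral_restrict_space nn_integral_completion)

lemma enn2real_pos: "0 < q \<Longrightarrow> q \<noteq> top \<Longrightarrow> 0 < enn2real q"
  by (simp add: enn2real_positive_iff less_top)

lemma ennpow_Lnorm:
  assumes "0 < q" "q \<noteq> top"
  shows "ennpow (Lnorm q a b g) (enn2real q) =
    (\<integral>\<^sup>+x. ennpow (g x) (enn2real q) * indicator {a<..<b} x \<partial>lborel)"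
  using enn2real_pos[OF assms] by (simp add: Lnorm_finite assms ennpow_ennpow)

lemma AE_lebesgue_on_interval:
  "(AE x in lebesgue_on {a<..<b}. P x) \<longleftrightarrow> (AE x in lborel. a < x \<and> x < b \<longrightarrow> P x)" for a b :: real
  by (simp add: AE_restrict_space_iff AE_completion_iff)

text \<open>Only \<open>g\<close> has to be measurable: the almost-everywhere bound by the essential
  supremum holds for every \<open>h\<close>, whereas bounding an essential supremum from above
  requires a measurable function.\<close>

lemma Lnorm_le:
  assumes q: "0 < q" and g: "g \<in> borel_measurable (lebesgue_on {a<..<b})"
    and outside: "\<And>x. a < x \<Longrightarrow> x < b \<Longrightarrow> \<not> (c < x \<and> x < d) \<Longrightarrow> g x = 0"
    and inside: "\<And>x. a < x \<Longrightarrow> x < b \<Longrightarrow> c < x \<Longrightarrow> x < d \<Longrightarrow> g x \<le> h x"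
  shows "Lnorm q a b g \<le> Lnorm q c d h"
proof (cases "q = top")
  case True
  have "AE x in lborel. c < x \<and> x < d \<longrightarrow> h x \<le> Lnorm q c d h"
    using esssup_AE[of h "lebesgue_on {c<..<d}"]
    by (simp add: True Lnorm_top AE_lebesgue_on_interval)
  then have "AE x in lborel. a < x \<and> x < b \<longrightarrow> g x \<le> Lnorm q c d h"
  proof eventually_elim
    case (elim x)
    then show ?case
      using outside[of x] inside[of x] by (cases "c < x \<and> x < d") (auto intro: order_trans)
  qed
  then have "AE x in lebesgue_on {a<..<b}. g x \<le> Lnorm q c d h"
    by (simp add: AE_lebesgue_on_interval)
  with g have "esssup (lebesgue_on {a<..<b}) g \<le> Lnorm q c d h"
    by (rule esssup_I)
  then show ?thesis
    by (simp add: True Lnorm_top)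
next
  case False
  note Q = enn2real_pos[OF q False]
  show ?thesis
    unfolding Lnorm_finite[OF q False]
  proof (intro ennpow_mono nn_integral_mono)
    fix x :: real
    show "ennpow (g x) (enn2real q) * indicator {a<..<b} x
        \<le> ennpow (h x) (enn2real q) * indicator {c<..<d} x"
      using outside[of x] inside[of x] Q by (auto simp: indicator_def ennpow_mono)
  qed (use Q in auto)
qed

lemma Lnorm_cmult_le:
  assumes q: "0 < q" and g: "g \<in> borel_measurable (lebesgue_on {a<..<b})"
  shows "Lnorm q a b (\<lambda>x. c * g x) \<le> c * Lnorm q a b g"
proof (cases "q = top")
  case True
  have "AE x in lebesgue_on {a<..<b}. c * g x \<le> c * Lnorm q a b g"
    using esssup_AE[of g "lebesgue_on {a<..<b}"] unfolding True Lnorm_top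
    by eventually_elim (rule mult_left_mono, auto)
  moreover have "(\<lambda>x. c * g x) \<in> borel_measurable (lebesgue_on {a<..<b})"
    using g by (intro borel_measurable_times_ennreal borel_measurable_const)
  ultimately have "esssup (lebesgue_on {a<..<b}) (\<lambda>x. c * g x) \<le> c * Lnorm q a b g"
    by (intro esssup_I)
  then show ?thesis
    by (simp add: True Lnorm_top)
next
  case False
  define Q where "Q = enn2real q"
  have Q: "0 < Q" unfolding Q_def by (rule enn2real_pos[OF q False])
  have "(\<integral>\<^sup>+x. ennpow (c * g x) Q \<partial>lebesgue_on {a<..<b})
      = (\<integral>\<^sup>+x. ennpow c Q * ennpow (g x) Q \<partial>lebesgue_on {a<..<b})"
    by (simp only: ennpow_mult)
  also have "\<dots> = ennpow c Q * (\<integral>\<^sup>+x. ennpow (g x) Q \<partial>lebesgue_on {a<..<b})"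
    by (rule nn_integral_cmult) (rule ennpow_measurable[OF g])
  finally have "Lnorm q a b (\<lambda>x. c * g x) = ennpow (ennpow c Q) (1 / Q) * Lnorm q a b g"
    by (simp add: Lnorm_def False recip_finite[OF False] ennpow_mult del: nn_integral_cmult flip: Q_def)
  then show ?thesis
    using Q by (simp add: ennpow_ennpow)
qed

text \<open>The opposite bound applied to the factor \<open>inverse c\<close>; finiteness of
  \<open>c\<close> makes \<open>inverse c * c = 1\<close>.\<close>

lemma Lnorm_cmult_ge:
  assumes q: "0 < q" and g: "g \<in> borel_measurable (lebesgue_on {a<..<b})" and c: "c < top"
  shows "c * Lnorm q a b g \<le> Lnorm q a b (\<lambda>x. c * g x)"
proof (cases "c = 0")
  case False
  have 1: "inverse c * c = 1" "c * inverse c = 1"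
    using c False ennreal_divide_self[of c] by (simp_all add: divide_ennreal_def mult.commute)
  have "Lnorm q a b (\<lambda>x. inverse c * (c * g x)) \<le> inverse c * Lnorm q a b (\<lambda>x. c * g x)"
    using g by (intro Lnorm_cmult_le[OF q] borel_measurable_times_ennreal borel_measurable_const)
  then have "c * Lnorm q a b g \<le> c * (inverse c * Lnorm q a b (\<lambda>x. c * g x))"
    by (intro mult_left_mono) (simp_all add: 1 flip: mult.assoc)
  then show ?thesis
    by (simp add: 1 flip: mult.assoc)
qed simp

lemma Lnorm_split:
  assumes q: "0 < q" and g [measurable]: "g \<in> borel_measurable borel"
  shows "Lnorm q a c g \<le> ennreal (2 powr recip q) * (Lnorm q a b g + Lnorm q b c g)"
proof (cases "q = top")
  case True
  have "AE x in lborel. x \<noteq> b"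
    by (rule AE_lborel_singleton)
  moreover have "AE x in lborel. a < x \<and> x < b \<longrightarrow> g x \<le> Lnorm q a b g"
    using esssup_AE[of g "lebesgue_on {a<..<b}"] by (simp add: True Lnorm_top AE_lebesgue_on_interval)
  moreover have "AE x in lborel. b < x \<and> x < c \<longrightarrow> g x \<le> Lnorm q b c g"
    using esssup_AE[of g "lebesgue_on {b<..<c}"] by (simp add: True Lnorm_top AE_lebesgue_on_interval)
  ultimately have "AE x in lborel. a < x \<and> x < c \<longrightarrow> g x \<le> Lnorm q a b g + Lnorm q b c g"
    by eventually_elim
      (metis add_increasing add_increasing2 linorder_neqE_linordered_idom zero_le)
  then have "AE x in lebesgue_on {a<..<c}. g x \<le> Lnorm q a b g + Lnorm q b c g"
    by (simp add: AE_lebesgue_on_interval)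
  then have "esssup (lebesgue_on {a<..<c}) g \<le> Lnorm q a b g + Lnorm q b c g"
    by (intro esssup_I) (simp_all add: measurable_completion measurable_restrict_space1)
  then show ?thesis
    by (simp add: True Lnorm_top)
next
  case False
  note Q = enn2real_pos[OF q False]
  let ?G = "\<lambda>x. ennpow (g x) (enn2real q)"
  have "AE x in lborel. x \<noteq> b"
    by (rule AE_lborel_singleton)
  then have "AE x in lborel. ?G x * indicator {a<..<c} x
      \<le> ?G x * indicator {a<..<b} x + ?G x * indicator {b<..<c} x"
    by eventually_elim (auto simp: indicator_def)
  then have "(\<integral>\<^sup>+x. ?G x * indicator {a<..<c} x \<partial>lborel)
      \<le> (\<integral>\<^sup>+x. ?G x * indicator {a<..<b} x + ?G x * indicator {b<..<c} x \<partial>lborel)"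
    by (rule nn_integral_mono_AE)
  also have "\<dots> = (\<integral>\<^sup>+x. ?G x * indicator {a<..<b} x \<partial>lborel) + (\<integral>\<^sup>+x. ?G x * indicator {b<..<c} x \<partial>lborel)"
    by (rule nn_integral_add) simp_all
  finally have "Lnorm q a c g
      \<le> ennpow ((\<integral>\<^sup>+x. ?G x * indicator {a<..<b} x \<partial>lborel) + (\<integral>\<^sup>+x. ?G x * indicator {b<..<c} x \<partial>lborel)) (1 / enn2real q)"
    using Q by (simp add: Lnorm_finite[OF q False] ennpow_mono)
  also have "\<dots> \<le> ennreal (2 powr recip q) * (Lnorm q a b g + Lnorm q b c g)"
    using ennpow_add_le[of "1 / enn2real q"] Q by (simp add: Lnorm_finite[OF q False] recip_finite[OF False])
  finally show ?thesis .
qed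

lemma borel_measurable_lebesgue_on:
  assumes "g \<in> borel_measurable borel"
  shows "g \<in> borel_measurable (lebesgue_on A)"
  using assms by (simp add: measurable_completion measurable_restrict_space1)

text \<open>After raising to the power \<open>q\<close> the left side is a double integral over the
  region \<open>l u < x < m u\<close>. Integrating in \<open>u\<close> first leaves the norm of the
  section of \<open>w\<close> at \<open>x\<close>, which \<open>\<omega> x\<close> bounds.
  Finiteness of \<open>w\<close> serves to draw the factor \<open>w u\<close> out of an essential
  supremum. All Hardy inequalities below are instances.\<close>

lemma Lnorm_Fubini_le:
  fixes l m :: "real \<Rightarrow> real"
  assumes q: "0 < q"
    and [measurable]: "k \<in> borel_measurable borel" "w \<in> borel_measurable borel"
      "l \<in> borel_measurable borel" "m \<in> borel_measurable borel"
    and fin: "\<And>u. w u < top"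
    and meas: "(\<lambda>u. Lnorm q (l u) (m u) k) \<in> borel_measurable borel"
    and sub: "\<And>u. a < u \<Longrightarrow> u < b \<Longrightarrow> a' \<le> l u \<and> m u \<le> b'"
    and le: "\<And>x. a' < x \<Longrightarrow> x < b' \<Longrightarrow> Lnorm q a b (\<lambda>u. w u * indicator {l u<..<m u} x) \<le> \<omega> x"
  shows "Lnorm q a b (\<lambda>u. w u * Lnorm q (l u) (m u) k) \<le> Lnorm q a' b' (\<lambda>x. \<omega> x * k x)"
proof -
  have [measurable]: "Measurable.pred (lborel \<Otimes>\<^sub>M lborel) (\<lambda>p. snd p \<in> {l (fst p)<..<m (fst p)})"
    unfolding greaterThanLessThan_iff by measurable
  show ?thesis
  proof (cases "q = top")
    case True
    define K where "K = Lnorm q a' b' (\<lambda>x. \<omega> x * k x)"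
    have "AE x in lborel. a' < x \<and> x < b' \<longrightarrow> \<omega> x * k x \<le> K"
      using esssup_AE[of "\<lambda>x. \<omega> x * k x" "lebesgue_on {a'<..<b'}"]
      by (simp add: True Lnorm_top AE_lebesgue_on_interval K_def)
    \<comment> \<open>The bound on the sections fixes \<open>x\<close> first and then gives almost
      every \<open>u\<close>; the outer norm on the left needs the opposite order.\<close>
    then have "AE x in lborel. AE u in lborel. a < u \<and> u < b \<and> x \<in> {l u<..<m u} \<longrightarrow> w u * k x \<le> K"
    proof eventually_elim
      case (elim x)
      show ?case
      proof (cases "a' < x \<and> x < b'")
        case inside: True
        have "AE u in lborel. a < u \<and> u < b \<longrightarrow> w u * indicator {l u<..<m u} x
            \<le> Lnorm q a b (\<lambda>u. w u * indicator {l u<..<m u} x)"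
          using esssup_AE[of "\<lambda>u. w u * indicator {l u<..<m u} x" "lebesgue_on {a<..<b}"]
          by (simp add: True Lnorm_top AE_lebesgue_on_interval)
        then show ?thesis
        proof eventually_elim
          case (elim u)
          show ?case
          proof
            assume *: "a < u \<and> u < b \<and> x \<in> {l u<..<m u}"
            then have "w u \<le> \<omega> x"
              using order_trans[OF _ le[of x]] elim inside by simp
            then have "w u * k x \<le> \<omega> x * k x"
              by (rule mult_right_mono) simp
            then show "w u * k x \<le> K"
              using inside \<open>a' < x \<and> x < b' \<longrightarrow> \<omega> x * k x \<le> K\<close> by auto
          qed
        qed
      next
        case False
        then have "\<not> (a < u \<and> u < b \<and> x \<in> {l u<..<m u})" for u
          using sub[of u] by auto
        then show ?thesis by (intro AE_I2) blast
      qed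
    qed
    \<comment> \<open>Measurability in the product is what permits exchanging the two
      quantifiers.\<close>
    moreover have "{p \<in> space (lborel \<Otimes>\<^sub>M lborel). a < fst p \<and> fst p < b \<and>
        snd p \<in> {l (fst p)<..<m (fst p)} \<longrightarrow> w (fst p) * k (snd p) \<le> K} \<in> sets (lborel \<Otimes>\<^sub>M lborel)"
      by measurable
    ultimately have "AE u in lborel. AE x in lborel. a < u \<and> u < b \<and> x \<in> {l u<..<m u} \<longrightarrow> w u * k x \<le> K"
      using lborel_pair.AE_commute[of
          "\<lambda>u x. a < u \<and> u < b \<and> x \<in> {l u<..<m u} \<longrightarrow> w u * k x \<le> K"] by blast
    then have "AE u in lborel. a < u \<and> u < b \<longrightarrow> w u * Lnorm q (l u) (m u) k \<le> K"
    proof eventually_elim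
      case (elim u)
      show ?case
      proof
        assume "a < u \<and> u < b"
        with elim have "AE x in lebesgue_on {l u<..<m u}. w u * k x \<le> K"
          by (simp add: AE_lebesgue_on_interval)
        then have "Lnorm q (l u) (m u) (\<lambda>x. w u * k x) \<le> K"
          unfolding True Lnorm_top by (intro esssup_I borel_measurable_lebesgue_on) simp_all
        with Lnorm_cmult_ge[OF q borel_measurable_lebesgue_on[OF \<open>k \<in> borel_measurable borel\<close>] fin]
        show "w u * Lnorm q (l u) (m u) k \<le> K"
          by (rule order_trans)
      qed
    qed
    then have "AE u in lebesgue_on {a<..<b}. w u * Lnorm q (l u) (m u) k \<le> K"
      by (simp add: AE_lebesgue_on_interval)
    moreover have "(\<lambda>u. w u * Lnorm q (l u) (m u) k) \<in> borel_measurable (lebesgue_on {a<..<b})"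
      using meas by (intro borel_measurable_lebesgue_on) simp
    ultimately show ?thesis
      unfolding K_def[symmetric] by (subst True) (simp add: Lnorm_top esssup_I)
  next
    case False
    define Q where "Q = enn2real q"
    have Q: "0 < Q" unfolding Q_def by (rule enn2real_pos[OF q False])
    let ?I = "\<lambda>u x. indicator {l u<..<m u} x :: ennreal"
    have [measurable]: "(\<lambda>u. ?I u x) \<in> borel_measurable borel" for x
      unfolding indicator_def of_bool_def greaterThanLessThan_iff by measurable
    have [measurable]: "(\<lambda>p. ?I (fst p) (snd p)) \<in> borel_measurable (lborel \<Otimes>\<^sub>M lborel)"
      unfolding indicator_def of_bool_def by measurable
    have "(\<integral>\<^sup>+u. ennpow (w u * Lnorm q (l u) (m u) k) Q * indicator {a<..<b} u \<partial>lborel)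
        = (\<integral>\<^sup>+u. (\<integral>\<^sup>+x. ennpow (w u) Q * indicator {a<..<b} u * (ennpow (k x) Q * ?I u x) \<partial>lborel) \<partial>lborel)"
      by (subst nn_integral_cmult)
        (simp_all add: ennpow_mult ennpow_Lnorm[OF q False, folded Q_def] ac_simps)
    also have "\<dots> = (\<integral>\<^sup>+x. (\<integral>\<^sup>+u. ennpow (w u) Q * indicator {a<..<b} u * (ennpow (k x) Q * ?I u x) \<partial>lborel) \<partial>lborel)"
      by (rule lborel_pair.Fubini'[symmetric]) (unfold split_beta, measurable)
    also have "\<dots> \<le> (\<integral>\<^sup>+x. ennpow (\<omega> x * k x) Q * indicator {a'<..<b'} x \<partial>lborel)"
    proof (rule nn_integral_mono)
      fix x :: real
      have "(\<integral>\<^sup>+u. ennpow (w u) Q * indicator {a<..<b} u * (ennpow (k x) Q * ?I u x) \<partial>lborel)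
        = ennpow (k x) Q * (\<integral>\<^sup>+u. ennpow (w u * ?I u x) Q * indicator {a<..<b} u \<partial>lborel)"
        by (subst nn_integral_cmult[symmetric]) (simp_all add: ennpow_indicator ac_simps)
      also have "\<dots> \<le> ennpow (\<omega> x * k x) Q * indicator {a'<..<b'} x"
      proof (cases "a' < x \<and> x < b'")
        case True
        then have "ennpow (Lnorm q a b (\<lambda>u. w u * ?I u x)) Q \<le> ennpow (\<omega> x) Q"
          using le Q by (simp add: ennpow_mono)
        then have "ennpow (k x) Q * (\<integral>\<^sup>+u. ennpow (w u * ?I u x) Q * indicator {a<..<b} u \<partial>lborel)
            \<le> ennpow (k x) Q * ennpow (\<omega> x) Q"
          unfolding ennpow_Lnorm[OF q \<open>q \<noteq> top\<close>, folded Q_def] by (rule mult_left_mono) simp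
        then show ?thesis
          using True by (simp add: ennpow_mult[of "\<omega> x"] mult.commute[of "ennpow (\<omega> x) Q"])
      next
        case False
        \<comment> \<open>By \<open>sub\<close>, an \<open>x\<close> outside \<open>(a', b')\<close>
          lies in none of the intervals \<open>(l u, m u)\<close> with \<open>u\<close> in
          \<open>(a, b)\<close>.\<close>
        then have zero: "ennpow (w u * ?I u x) Q * indicator {a<..<b} u = 0" for u
          using sub[of u] by (auto simp: indicator_def)
        show ?thesis by (simp only: zero) simp
      qed
      finally show "(\<integral>\<^sup>+u. ennpow (w u) Q * indicator {a<..<b} u * (ennpow (k x) Q * ?I u x) \<partial>lborel)
          \<le> ennpow (\<omega> x * k x) Q * indicator {a'<..<b'} x" .
    qed
    finally show ?thesis
      using Q by (simp add: Lnorm_finite[OF q False] ennpow_mono flip: Q_def)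
  qed
qed

section \<open>Norms with respect to the invariant measure\<close>

text \<open>The \<open>L^q\<close> norm for \<open>dx/x\<close>: putting the density inside as
  \<open>x powr - recip q\<close> treats all exponents at once, since for \<open>q = top\<close>
  this factor is \<open>1\<close> at every \<open>x \<noteq> 0\<close>.\<close>

definition Mnorm :: "ennreal \<Rightarrow> real \<Rightarrow> real \<Rightarrow> (real \<Rightarrow> ennreal) \<Rightarrow> ennreal" where
  "Mnorm q a b g = Lnorm q a b (\<lambda>x. ennreal (x powr - recip q) * g x)"

lemma measurable_weight:
  assumes "g \<in> borel_measurable (lebesgue_on A)"
  shows "(\<lambda>x. ennreal (x powr a) * g x) \<in> borel_measurable (lebesgue_on A)"
  by (intro borel_measurable_times_ennreal assms borel_measurable_lebesgue_on) simp

lemma Mnorm_le: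
  assumes "0 < q" and "g \<in> borel_measurable (lebesgue_on {a<..<b})"
    and "\<And>x. a < x \<Longrightarrow> x < b \<Longrightarrow> \<not> (c < x \<and> x < d) \<Longrightarrow> g x = 0"
    and "\<And>x. a < x \<Longrightarrow> x < b \<Longrightarrow> c < x \<Longrightarrow> x < d \<Longrightarrow> g x \<le> h x"
  shows "Mnorm q a b g \<le> Mnorm q c d h"
  unfolding Mnorm_def using assms by (intro Lnorm_le measurable_weight) (auto intro: mult_left_mono)

lemma Mnorm_mono:
  assumes "0 < q" and "g \<in> borel_measurable (lebesgue_on {a<..<b})"
    and "\<And>x. a < x \<Longrightarrow> x < b \<Longrightarrow> g x \<le> h x"
  shows "Mnorm q a b g \<le> Mnorm q a b h"
  using assms by (intro Mnorm_le) auto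

lemma Mnorm_subinterval:
  assumes "0 < q" and "g \<in> borel_measurable borel" "c \<le> a" "b \<le> d"
  shows "Mnorm q a b g \<le> Mnorm q c d g"
  using assms by (intro Mnorm_le borel_measurable_lebesgue_on) auto

lemma Mnorm_cmult_le:
  assumes "0 < q" and "g \<in> borel_measurable (lebesgue_on {a<..<b})"
  shows "Mnorm q a b (\<lambda>x. c * g x) \<le> c * Mnorm q a b g"
  using Lnorm_cmult_le[OF assms(1) measurable_weight[OF assms(2)], of c]
  by (simp add: Mnorm_def ac_simps)

lemma Mnorm_le_cmult:
  assumes "0 < q" and g: "g \<in> borel_measurable (lebesgue_on {a<..<b})"
    and h: "h \<in> borel_measurable (lebesgue_on {a<..<b})"
    and "\<And>x. a < x \<Longrightarrow> x < b \<Longrightarrow> g x \<le> c * h x"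
  shows "Mnorm q a b g \<le> c * Mnorm q a b h"
  using Mnorm_mono[OF assms(1) g assms(4)] Mnorm_cmult_le[OF assms(1) h] by (blast intro: order_trans)

lemma Mnorm_split:
  assumes "0 < q" and "g \<in> borel_measurable borel"
  shows "Mnorm q a c g \<le> ennreal (2 powr recip q) * (Mnorm q a b g + Mnorm q b c g)"
  unfolding Mnorm_def using assms by (intro Lnorm_split) measurable

lemma Mnorm_Fubini_le:
  fixes l m :: "real \<Rightarrow> real"
  assumes q: "0 < q"
    and [measurable]: "k \<in> borel_measurable borel" "w \<in> borel_measurable borel"
      "l \<in> borel_measurable borel" "m \<in> borel_measurable borel"
    and fin: "\<And>u. w u < top"
    and meas: "(\<lambda>u. Mnorm q (l u) (m u) k) \<in> borel_measurable borel"
    and sub: "\<And>u. a < u \<Longrightarrow> u < b \<Longrightarrow> a' \<le> l u \<and> m u \<le> b'"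
    and le: "\<And>x. a' < x \<Longrightarrow> x < b' \<Longrightarrow> Mnorm q a b (\<lambda>u. w u * indicator {l u<..<m u} x) \<le> \<omega> x"
  shows "Mnorm q a b (\<lambda>u. w u * Mnorm q (l u) (m u) k) \<le> Mnorm q a' b' (\<lambda>x. \<omega> x * k x)"
proof -
  have "Lnorm q a b (\<lambda>u. (ennreal (u powr - recip q) * w u) *
        Lnorm q (l u) (m u) (\<lambda>x. ennreal (x powr - recip q) * k x))
      \<le> Lnorm q a' b' (\<lambda>x. \<omega> x * (ennreal (x powr - recip q) * k x))"
  proof (rule Lnorm_Fubini_le[where l = l and m = m])
    show "ennreal (u powr - recip q) * w u < top" for u
      using fin[of u] by (simp add: ennreal_mult_less_top)
  qed (use q meas le sub in \<open>simp_all add: Mnorm_def mult.assoc\<close>)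
  then show ?thesis
    by (simp add: Mnorm_def ac_simps)
qed

text \<open>The interval \<open>(v / 2, v)\<close> has length \<open>v / 2\<close> and density at
  least \<open>1 / v\<close>, hence mass at least \<open>1 / 2\<close> for \<open>dx/x\<close>,
  independently of \<open>v\<close>. This is the origin of the constant
  \<open>2 powr recip q\<close>.\<close>

lemma le_Mnorm:
  assumes q: "0 < q" and v: "0 < v" and ab: "a \<le> v / 2" "v \<le> b"
    and g: "\<And>x. v / 2 < x \<Longrightarrow> x < v \<Longrightarrow> m \<le> g x"
  shows "m \<le> ennreal (2 powr recip q) * Mnorm q a b g"
proof -
  have "m \<le> ennreal (2 powr recip q) * Mnorm q (v / 2) v (\<lambda>_. m)"
  proof (cases "q = top")
    case True
    \<comment> \<open>For \<open>q = top\<close> it only matters that the interval has positive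
      measure, so that a constant is its own essential supremum.\<close>
    have "{v / 2<..<v} = space (lebesgue_on {v / 2<..<v})"
      by simp
    then have "emeasure (lebesgue_on {v / 2<..<v}) (space (lebesgue_on {v / 2<..<v})) \<noteq> 0"
      using v by (simp add: emeasure_restrict_space)
    then have "esssup (lebesgue_on {v / 2<..<v}) (\<lambda>_. m) = m"
      by (rule esssup_const)
    moreover have "m = esssup (lebesgue_on {v / 2<..<v}) (\<lambda>_. m)
        \<Longrightarrow> m \<le> Lnorm top (v / 2) v (\<lambda>x. ennreal (x powr 0) * m)"
      using Lnorm_le[of top "\<lambda>_. m" "v / 2" v "v / 2" v "\<lambda>x. ennreal (x powr 0) * m"] v
      by (simp add: Lnorm_top)
    ultimately show ?thesis
      by (simp add: True Mnorm_def)
  next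
    case False
    define Q where "Q = enn2real q"
    have Q: "0 < Q" unfolding Q_def by (rule enn2real_pos[OF q False])
    have rq: "recip q = 1 / Q" by (simp add: recip_finite False Q_def)
    have "ennpow m Q = 2 * (ennreal (1 / v) * ennpow m Q * emeasure lborel {v / 2<..<v})"
    proof -
      have "2 * (ennreal (1 / v) * ennpow m Q * emeasure lborel {v / 2<..<v})
        = (ennreal 2 * ennreal (1 / v) * ennreal (v / 2)) * ennpow m Q"
        using v by (simp add: ac_simps)
      also have "ennreal 2 * ennreal (1 / v) * ennreal (v / 2) = 1"
        using v by (simp add: ennreal_mult[symmetric] del: ennreal_numeral)
      finally show ?thesis by simp
    qed
    also have "ennreal (1 / v) * ennpow m Q * emeasure lborel {v / 2<..<v}
        = (\<integral>\<^sup>+x. ennreal (1 / v) * ennpow m Q * indicator {v / 2<..<v} x \<partial>lborel)"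
      by (rule nn_integral_cmult_indicator[symmetric]) simp
    also have "\<dots> \<le> (\<integral>\<^sup>+x. ennpow (ennreal (x powr - (1 / Q)) * m) Q * indicator {v / 2<..<v} x \<partial>lborel)"
    proof (rule nn_integral_mono)
      fix x :: real
      have "1 / v \<le> x powr - 1" if "v / 2 < x" "x < v"
        using that v by (simp add: powr_minus_divide frac_le)
      then show "ennreal (1 / v) * ennpow m Q * indicator {v / 2<..<v} x
          \<le> ennpow (ennreal (x powr - (1 / Q)) * m) Q * indicator {v / 2<..<v} x"
        using Q by (auto simp: indicator_def ennpow_mult ennpow_ennreal powr_powr intro!: mult_right_mono ennreal_leI)
    qed
    also have "\<dots> = ennpow (Mnorm q (v / 2) v (\<lambda>_. m)) Q"
      by (simp add: Mnorm_def ennpow_Lnorm[OF q False, folded Q_def] rq)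
    finally have "ennpow m Q \<le> 2 * ennpow (Mnorm q (v / 2) v (\<lambda>_. m)) Q"
      by (simp add: mult_left_mono)
    also have "2 = ennpow (ennreal (2 powr recip q)) Q"
      using Q by (simp add: ennpow_ennreal powr_powr rq)
    finally show ?thesis
      using Q by (simp add: ennpow_le_iff flip: ennpow_mult)
  qed
  also have "\<dots> \<le> ennreal (2 powr recip q) * Mnorm q a b g"
    using ab g by (intro mult_left_mono Mnorm_le[OF q]) auto
  finally show ?thesis .
qed

section \<open>Norms of powers, and dilations\<close>

lemma Mnorm_powr_le:
  assumes q: "0 < q" and \<gamma>: "0 < \<gamma>"
  shows "\<exists>C>0. \<forall>t>0. Mnorm q 0 t (\<lambda>x. ennreal (x powr \<gamma>)) \<le> ennreal (C * t powr \<gamma>)"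
proof (cases "q = top")
  case True
  have "Mnorm q 0 t (\<lambda>x. ennreal (x powr \<gamma>)) \<le> ennreal (t powr \<gamma>)" if "0 < t" for t
    unfolding True Mnorm_def Lnorm_top
    by (intro esssup_I borel_measurable_lebesgue_on AE_I2)
      (use \<gamma> in \<open>auto intro!: ennreal_leI powr_mono2\<close>)
  then show ?thesis by (intro exI[of _ 1]) simp
next
  case False
  define Q where "Q = enn2real q"
  have Q: "0 < Q" unfolding Q_def by (rule enn2real_pos[OF q False])
  have rq: "recip q = 1 / Q" by (simp add: recip_finite False Q_def)
  show ?thesis
  proof (intro exI[of _ "(1 / (\<gamma> * Q)) powr (1 / Q)"] conjI allI impI)
    fix t :: real
    assume t: "0 < t"
    have "(\<integral>\<^sup>+x. ennpow (ennreal (x powr - (1 / Q)) * ennreal (x powr \<gamma>)) Q * indicator {0<..<t} x \<partial>lborel)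
        \<le> (\<integral>\<^sup>+x. ennreal (indicator {0..t} x * x powr (\<gamma> * Q - 1)) \<partial>lborel)"
      using Q by (intro nn_integral_mono)
        (auto simp: indicator_def ennpow_ennreal powr_powr algebra_simps diff_divide_distrib
          simp flip: ennreal_mult powr_add)
    also have "\<dots> = ennreal (t powr (\<gamma> * Q) / (\<gamma> * Q))"
      using nn_integral_has_integral_lebesgue[OF _ has_integral_powr_from_0[of "\<gamma> * Q - 1" t]] \<gamma> Q t
      by simp
    finally have "ennpow (\<integral>\<^sup>+x. ennpow (ennreal (x powr - (1 / Q)) * ennreal (x powr \<gamma>)) Q * indicator {0<..<t} x \<partial>lborel) (1 / Q)
        \<le> ennpow (ennreal (t powr (\<gamma> * Q) / (\<gamma> * Q))) (1 / Q)"
      using Q by (intro ennpow_mono) auto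
    also have "\<dots> = ennreal ((1 / (\<gamma> * Q)) powr (1 / Q) * t powr \<gamma>)"
      using \<gamma> Q t by (simp add: ennpow_ennreal powr_divide powr_powr)
    finally show "Mnorm q 0 t (\<lambda>x. ennreal (x powr \<gamma>)) \<le> ennreal ((1 / (\<gamma> * Q)) powr (1 / Q) * t powr \<gamma>)"
      by (simp add: Mnorm_def Lnorm_finite[OF q False] rq flip: Q_def)
  qed (use \<gamma> Q in auto)
qed

text \<open>A negative power is integrable up to infinity for \<open>dx/x\<close>, so the constant
  is uniform in the right endpoint \<open>T\<close>.\<close>

lemma Mnorm_powr_neg_le:
  assumes q: "0 < q" and \<gamma>: "0 < \<gamma>"
  shows "\<exists>C>0. \<forall>t>0. \<forall>T. Mnorm q t T (\<lambda>x. ennreal (x powr - \<gamma>)) \<le> ennreal (C * t powr - \<gamma>)"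
proof (cases "q = top")
  case True
  have "Mnorm q t T (\<lambda>x. ennreal (x powr - \<gamma>)) \<le> ennreal (t powr - \<gamma>)" if "0 < t" for t T
    unfolding True Mnorm_def Lnorm_top
    by (intro esssup_I borel_measurable_lebesgue_on AE_I2)
      (use \<gamma> that in \<open>auto intro!: ennreal_leI powr_mono2'\<close>)
  then show ?thesis by (intro exI[of _ 1]) simp
next
  case False
  define Q where "Q = enn2real q"
  have Q: "0 < Q" unfolding Q_def by (rule enn2real_pos[OF q False])
  have rq: "recip q = 1 / Q" by (simp add: recip_finite False Q_def)
  show ?thesis
  proof (intro exI[of _ "(1 / (\<gamma> * Q)) powr (1 / Q)"] conjI allI impI)
    fix t T :: real
    assume t: "0 < t"
    have "(\<integral>\<^sup>+x. ennpow (ennreal (x powr - (1 / Q)) * ennreal (x powr - \<gamma>)) Q * indicator {t<..<T} x \<partial>lborel)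
        \<le> (\<integral>\<^sup>+x. ennreal (indicator {t..} x * x powr (- (\<gamma> * Q) - 1)) \<partial>lborel)"
      using Q t by (intro nn_integral_mono)
        (auto simp: indicator_def ennpow_ennreal powr_powr algebra_simps diff_divide_distrib
          simp flip: ennreal_mult powr_add)
    also have "\<dots> = ennreal (t powr - (\<gamma> * Q) / (\<gamma> * Q))"
      using nn_integral_has_integral_lebesgue[OF _ has_integral_powr_to_inf[of "- (\<gamma> * Q) - 1" t]] \<gamma> Q t
      by simp
    finally have "ennpow (\<integral>\<^sup>+x. ennpow (ennreal (x powr - (1 / Q)) * ennreal (x powr - \<gamma>)) Q * indicator {t<..<T} x \<partial>lborel) (1 / Q)
        \<le> ennpow (ennreal (t powr - (\<gamma> * Q) / (\<gamma> * Q))) (1 / Q)"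
      using Q by (intro ennpow_mono) auto
    also have "\<dots> = ennreal ((1 / (\<gamma> * Q)) powr (1 / Q) * t powr - \<gamma>)"
      using \<gamma> Q t by (simp add: ennpow_ennreal powr_divide powr_powr)
    finally show "Mnorm q t T (\<lambda>x. ennreal (x powr - \<gamma>)) \<le> ennreal ((1 / (\<gamma> * Q)) powr (1 / Q) * t powr - \<gamma>)"
      by (simp add: Mnorm_def Lnorm_finite[OF q False] rq flip: Q_def)
  qed (use \<gamma> Q in auto)
qed

lemma Mnorm_dilate_le:
  assumes q: "0 < q" and [measurable]: "g \<in> borel_measurable borel"
  shows "Mnorm q 0 t (\<lambda>u. g (u / 2)) \<le> Mnorm q 0 (t / 2) g"
proof (cases "q = top")
  case True
  define K where "K = Lnorm top 0 (t / 2) (\<lambda>x. ennreal (x powr 0) * g x)"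
  have "AE x in lborel. 0 < x \<and> x < t / 2 \<longrightarrow> ennreal (x powr 0) * g x \<le> K"
    using esssup_AE[of "\<lambda>x. ennreal (x powr 0) * g x" "lebesgue_on {0<..<t / 2}"]
    unfolding AE_lebesgue_on_interval K_def Lnorm_top .
  then have "AE x in lborel. 0 < 0 + (1 / 2) * x \<and> 0 + (1 / 2) * x < t / 2 \<longrightarrow>
      ennreal ((0 + (1 / 2) * x) powr 0) * g (0 + (1 / 2) * x) \<le> K"
    by (intro AE_borel_affine) simp_all
  then have "AE x in lborel. 0 < x \<and> x < t \<longrightarrow> ennreal (x powr 0) * g (x / 2) \<le> K"
    by eventually_elim auto
  then have "AE x in lebesgue_on {0<..<t}. ennreal (x powr 0) * g (x / 2) \<le> K"
    by (simp only: AE_lebesgue_on_interval)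
  then have "Lnorm top 0 t (\<lambda>x. ennreal (x powr 0) * g (x / 2)) \<le> K"
    unfolding Lnorm_top by (intro esssup_I borel_measurable_lebesgue_on) simp_all
  then show ?thesis
    by (simp add: True Mnorm_def K_def)
next
  case False
  define Q where "Q = enn2real q"
  have Q: "0 < Q" unfolding Q_def by (rule enn2real_pos[OF q False])
  have rq: "recip q = 1 / Q" by (simp add: recip_finite False Q_def)
  let ?F = "\<lambda>u. ennpow (ennreal (u powr - (1 / Q)) * g (u / 2)) Q * indicator {0<..<t} u"
  have "(\<integral>\<^sup>+u. ?F u \<partial>lborel) = ennreal 2 * (\<integral>\<^sup>+x. ?F (0 + 2 * x) \<partial>lborel)"
    by (subst nn_integral_real_affine[where c = 2 and t = 0]) simp_all
  also have "\<dots> = (\<integral>\<^sup>+x. ennreal 2 * ?F (0 + 2 * x) \<partial>lborel)"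
    by (rule nn_integral_cmult[symmetric]) simp
  also have "\<dots> = (\<integral>\<^sup>+x. ennpow (ennreal (x powr - (1 / Q)) * g x) Q * indicator {0<..<t / 2} x \<partial>lborel)"
  proof (rule nn_integral_cong)
    fix x :: real
    \<comment> \<open>The Jacobian \<open>2\<close> cancels against the density
      \<open>1 / (2 * x)\<close>.\<close>
    have "ennreal 2 * ennreal ((2 * x) powr - 1) = ennreal (x powr - 1)" if "0 < x"
      using that by (simp add: powr_minus_divide ennreal_mult[symmetric] del: ennreal_numeral)
    then show "ennreal 2 * ?F (0 + 2 * x)
        = ennpow (ennreal (x powr - (1 / Q)) * g x) Q * indicator {0<..<t / 2} x"
      using Q by (auto simp: indicator_def ennpow_mult ennpow_ennreal powr_powr simp flip: mult.assoc)
  qed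
  finally show ?thesis
    by (simp add: Mnorm_def Lnorm_finite[OF q False] rq flip: Q_def)
qed

section \<open>Slowly varying weights and averages of monotone functions\<close>

lemma is_interval_superlevel:
  fixes F :: "real \<Rightarrow> 'a :: linorder"
  assumes "is_interval S" and "mono_on S F \<or> antimono_on S F"
  shows "is_interval {x \<in> S. y < F x}"
  unfolding is_interval_1
proof safe
  fix s t x
  assume *: "s \<in> S" "t \<in> S" "s \<le> x" "x \<le> t" "y < F s" "y < F t"
  show "x \<in> S" using assms(1) * unfolding is_interval_1 by blast
  then have "F s \<le> F x \<or> F t \<le> F x"
    using assms(2) * by (auto simp: monotone_on_def)
  then show "y < F x" using * by auto
qed

text \<open>Superlevel sets are intervals. This spares any measurability argument for parametrised
  integrals: the norms that occur inside other norms are monotone in their parameter.\<close>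

lemma borel_measurable_monotone:
  fixes F :: "real \<Rightarrow> ennreal"
  assumes "mono F \<or> antimono F"
  shows "F \<in> borel_measurable borel"
proof (rule borel_measurableI_greater)
  fix y
  show "{x \<in> space borel. y < F x} \<in> sets borel"
    using is_interval_superlevel[of UNIV F y] assms
    by (simp add: is_interval_univ real_interval_borel_measurable)
qed

lemma borel_measurable_lebesgue_on_monotone:
  fixes F :: "real \<Rightarrow> ennreal"
  assumes "mono_on {a<..<b} F \<or> antimono_on {a<..<b} F"
  shows "F \<in> borel_measurable (lebesgue_on {a<..<b})"
proof (rule borel_measurableI_greater)
  fix y
  have "is_interval {x \<in> {a<..<b}. y < F x}"
    using assms by (intro is_interval_superlevel) (auto simp: is_interval_1)
  then have "{x \<in> {a<..<b}. y < F x} \<in> sets lebesgue"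
    by (intro sets_completionI_sets) (simp add: real_interval_borel_measurable)
  then show "{x \<in> space (lebesgue_on {a<..<b}). y < F x} \<in> sets (lebesgue_on {a<..<b})"
    by (auto simp: sets_restrict_space_iff)
qed

section \<open>Slowly varying functions\<close>

lemma SV_measurable:
  assumes "d \<in> SV" "0 \<le> a" "b \<le> 1"
  shows "d \<in> borel_measurable (lebesgue_on {a<..<b})"
proof -
  have "d \<in> borel_measurable (lebesgue_on {0<..<1})"
    using assms(1) unfolding SV_def by blast
  then show ?thesis
    by (rule measurable_restrict_mono) (use assms in auto)
qed

lemma SV_pos:
  assumes "d \<in> SV" "0 < t" "t < 1"
  shows "0 < d t"
proof -
  have "\<forall>t\<in>{0<..<1}. 0 < d t"
    using assms(1) unfolding SV_def by blast
  with assms show ?thesis by simp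
qed

lemma SV_equivalent_mono:
  assumes d: "d \<in> SV" and \<epsilon>: "0 < \<epsilon>"
  obtains g c C where "mono_on {0<..<1} g" "0 < c" "c \<le> C"
    "\<And>t. 0 < t \<Longrightarrow> t < 1 \<Longrightarrow> c * g t \<le> t powr \<epsilon> * d t \<and> t powr \<epsilon> * d t \<le> C * g t"
proof -
  from d have "\<forall>\<epsilon>>0. \<exists>g :: real \<Rightarrow> real. mono_on {0<..<1} g \<and> (\<exists>c C. 0 < c \<and> c \<le> C \<and>
      (\<forall>t\<in>{0<..<1}. c * g t \<le> t powr \<epsilon> * d t \<and> t powr \<epsilon> * d t \<le> C * g t))"
    unfolding SV_def by blast
  with \<epsilon> obtain g :: "real \<Rightarrow> real" and c C where "mono_on {0<..<1} g" "0 < c" "c \<le> C"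
      "\<forall>t\<in>{0<..<1}. c * g t \<le> t powr \<epsilon> * d t \<and> t powr \<epsilon> * d t \<le> C * g t"
    by blast
  then show thesis
    by (intro that[of g c C]) simp_all
qed

text \<open>Eliminates the monotone companion of \<open>d\<close> in favour of a two-point
  inequality, the form in which slow variation is used.\<close>

lemma SV_almost_increasing:
  assumes d: "d \<in> SV" and \<epsilon>: "0 < \<epsilon>"
  obtains C where "0 < C"
    "\<And>s t. 0 < s \<Longrightarrow> s \<le> t \<Longrightarrow> t < 1 \<Longrightarrow> s powr \<epsilon> * d s \<le> C * (t powr \<epsilon> * d t)"
proof -
  obtain g c C where g: "mono_on {0<..<1} g" "0 < c" "c \<le> C"
    "\<And>t. 0 < t \<Longrightarrow> t < 1 \<Longrightarrow> c * g t \<le> t powr \<epsilon> * d t \<and> t powr \<epsilon> * d t \<le> C * g t"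
    using SV_equivalent_mono[OF d \<epsilon>] by blast
  have "s powr \<epsilon> * d s \<le> C / c * (t powr \<epsilon> * d t)" if "0 < s" "s \<le> t" "t < 1" for s t
  proof -
    have "s powr \<epsilon> * d s \<le> C * g s" using g(4)[of s] that by simp
    also have "\<dots> \<le> C * g t" using g(1-3) that by (intro mult_left_mono) (auto simp: monotone_on_def)
    also have "\<dots> = C / c * (c * g t)" using g by simp
    also have "\<dots> \<le> C / c * (t powr \<epsilon> * d t)" using g(2,3) g(4)[of t] that by (intro mult_left_mono) auto
    finally show ?thesis .
  qed
  then show thesis using g(2,3) by (intro that[of "C / c"]) auto
qed

lemma SV_almost_decreasing:
  assumes d: "d \<in> SV" and \<epsilon>: "0 < \<epsilon>"
  obtains C where "0 < C"
    "\<And>s t. 0 < s \<Longrightarrow> s \<le> t \<Longrightarrow> t < 1 \<Longrightarrow> t powr - \<epsilon> * d t \<le> C * (s powr - \<epsilon> * d s)"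
proof -
  obtain g c C where g: "antimono_on {0<..<1} g" "0 < c" "c \<le> C"
    "\<And>t. 0 < t \<Longrightarrow> t < 1 \<Longrightarrow> c * g t \<le> t powr - \<epsilon> * d t \<and> t powr - \<epsilon> * d t \<le> C * g t"
    using d \<epsilon> unfolding SV_def by fastforce
  have "t powr - \<epsilon> * d t \<le> C / c * (s powr - \<epsilon> * d s)" if "0 < s" "s \<le> t" "t < 1" for s t
  proof -
    have "t powr - \<epsilon> * d t \<le> C * g t" using g(4)[of t] that by simp
    also have "\<dots> \<le> C * g s" using g(1-3) that by (intro mult_left_mono) (auto simp: monotone_on_def)
    also have "\<dots> = C / c * (c * g s)" using g by simp
    also have "\<dots> \<le> C / c * (s powr - \<epsilon> * d s)" using g(2,3) g(4)[of s] that by (intro mult_left_mono) auto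
    finally show ?thesis .
  qed
  then show thesis using g(2,3) by (intro that[of "C / c"]) auto
qed

text \<open>A function in \<open>SV\<close> is only Lebesgue measurable, while the exchange of norms
  is done over the product of two copies of \<open>lborel\<close> and asks for Borel weights. The
  monotone function equivalent to \<open>t * b t\<close> is Borel, and dividing it by
  \<open>t\<close> gives \<open>b'\<close>.\<close>

lemma SV_equivalent_borel:
  assumes b: "b \<in> SV"
  obtains b' c C where "b' \<in> borel_measurable borel" "\<And>t. 0 \<le> b' t" "0 < c" "0 < C"
    "\<And>t. 0 < t \<Longrightarrow> t < 1 \<Longrightarrow> c * b' t \<le> b t \<and> b t \<le> C * b' t"
proof -
  obtain g c C where g: "mono_on {0<..<1} g" "0 < c" "c \<le> C"
    "\<And>t. 0 < t \<Longrightarrow> t < 1 \<Longrightarrow> c * g t \<le> t powr 1 * b t \<and> t powr 1 * b t \<le> C * g t"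
    using SV_equivalent_mono[OF b zero_less_one] by blast
  have pos: "0 \<le> g t" if "0 < t" "t < 1" for t
  proof -
    have "0 < t powr 1 * b t"
      using SV_pos[OF b, of t] that by simp
    also have "\<dots> \<le> C * g t"
      using g(4)[of t] that by blast
    finally show ?thesis
      using g(2,3) by (simp add: zero_less_mult_iff)
  qed
  \<comment> \<open>The values \<open>0\<close> and \<open>top\<close> outside \<open>(0, 1)\<close>
    keep the extension monotone on the whole line; \<open>enn2real\<close> sends both to
    \<open>0\<close> afterwards.\<close>
  define F where "F t = (if t \<le> 0 then 0 else if t < 1 then ennreal (g t) else top)" for t
  have "mono F"
    using g(1) by (auto simp: mono_def F_def monotone_on_def intro!: ennreal_leI)
  then have [measurable]: "F \<in> borel_measurable borel"
    by (intro borel_measurable_monotone) simp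
  show thesis
  proof (rule that[of "\<lambda>t. enn2real (F t) / t powr 1"])
    show "(\<lambda>t. enn2real (F t) / t powr 1) \<in> borel_measurable borel" by measurable
    fix t :: real assume "0 < t" "t < 1"
    then show "c * (enn2real (F t) / t powr 1) \<le> b t \<and> b t \<le> C * (enn2real (F t) / t powr 1)"
      using g(4)[of t] pos[of t] by (simp add: F_def field_simps)
  qed (use g in auto)
qed

text \<open>Here \<open>a\<close> stands for \<open>1 / U\<close>, and in \<open>Hlow\<close> for
  \<open>1 / V\<close>, so that \<open>V = \<infinity>\<close> becomes \<open>a = 0\<close>. A
  general \<open>h\<close> replaces \<open>rearr f\<close>, since monotonicity is the only property
  of the rearrangement that enters.\<close>

definition Hup :: "real \<Rightarrow> ennreal \<Rightarrow> (real \<Rightarrow> real) \<Rightarrow> (real \<Rightarrow> ennreal) \<Rightarrow> real \<Rightarrow> ennreal" where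
  "Hup a W d h t = ennreal (inverse (t powr a * d t)) *
     Mnorm W 0 t (\<lambda>v. ennreal (v powr a * d v) * h v)"

definition Hlow :: "real \<Rightarrow> ennreal \<Rightarrow> (real \<Rightarrow> real) \<Rightarrow> (real \<Rightarrow> ennreal) \<Rightarrow> real \<Rightarrow> ennreal" where
  "Hlow a W d h t = ennreal (inverse (t powr a * d t)) *
     Mnorm W t 1 (\<lambda>v. ennreal (v powr a * d v) * h v)"

lemma measurable_SV_weight:
  assumes d: "d \<in> SV" and h: "antimono h" and ab: "0 \<le> l" "m \<le> 1"
  shows "(\<lambda>v. ennreal (v powr a * d v) * h v) \<in> borel_measurable (lebesgue_on {l<..<m})"
proof -
  have [measurable]: "d \<in> borel_measurable (lebesgue_on {l<..<m})" "h \<in> borel_measurable (lebesgue_on {l<..<m})"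
      "(\<lambda>v. v powr a) \<in> borel_measurable (lebesgue_on {l<..<m})"
    using SV_measurable[OF d ab] h
    by (auto intro!: borel_measurable_lebesgue_on borel_measurable_monotone)
  show ?thesis by measurable
qed

lemma measurable_SV_inverse:
  assumes d: "d \<in> SV"
  shows "(\<lambda>v. ennreal (inverse (v powr a * d v))) \<in> borel_measurable (lebesgue_on {0<..<1})"
proof -
  have [measurable]: "d \<in> borel_measurable (lebesgue_on {0<..<1})"
      "(\<lambda>v. v powr a) \<in> borel_measurable (lebesgue_on {0<..<1})"
    using SV_measurable[OF d, of 0 1] by (auto intro!: borel_measurable_lebesgue_on)
  show ?thesis by measurable
qed

lemma measurable_Hup:
  assumes d: "d \<in> SV" and h: "antimono h" and W: "0 < W"
  shows "Hup a W d h \<in> borel_measurable (lebesgue_on {0<..<1})"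
proof -
  have "mono_on {0<..<1} (\<lambda>t. Mnorm W 0 t (\<lambda>v. ennreal (v powr a * d v) * h v))"
    by (auto simp: monotone_on_def intro!: Mnorm_le W measurable_SV_weight d h)
  then show ?thesis
    unfolding Hup_def
    by (intro borel_measurable_times_ennreal borel_measurable_lebesgue_on_monotone measurable_SV_inverse[OF d]) simp
qed

lemma measurable_Hlow:
  assumes d: "d \<in> SV" and h: "antimono h" and W: "0 < W"
  shows "Hlow a W d h \<in> borel_measurable (lebesgue_on {0<..<1})"
proof -
  have "antimono_on {0<..<1} (\<lambda>t. Mnorm W t 1 (\<lambda>v. ennreal (v powr a * d v) * h v))"
    by (auto simp: monotone_on_def intro!: Mnorm_le W measurable_SV_weight d h)
  then show ?thesis
    unfolding Hlow_def
    by (intro borel_measurable_times_ennreal borel_measurable_lebesgue_on_monotone measurable_SV_inverse[OF d]) simp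
qed

section \<open>Pointwise bounds for the averages\<close>

lemma le_inverse_mult:
  assumes x: "0 < x" and C: "0 \<le> C" and le: "ennreal x * y \<le> ennreal C * z"
  shows "y \<le> ennreal C * (ennreal (inverse x) * z)"
proof -
  have "y = ennreal (inverse x) * (ennreal x * y)"
    using x by (simp add: ennreal_mult[symmetric] flip: mult.assoc)
  also have "\<dots> \<le> ennreal (inverse x) * (ennreal C * z)"
    by (rule mult_left_mono[OF le]) simp
  finally show ?thesis by (simp add: ac_simps)
qed

text \<open>On \<open>(t / 2, t)\<close> one has \<open>h \<ge> h t\<close>, and the weight
  \<open>v powr a * d v\<close> is at least a constant multiple of its value at \<open>t\<close>; so
  the part of the average over this interval suffices. In \<open>?K\<close> the factor
  \<open>2 powr a\<close> comes from the power and \<open>2 * C\<close> from \<open>d\<close>, both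
  because \<open>t < 2 * v\<close>.\<close>

lemma Hup_ge:
  assumes d: "d \<in> SV" and W: "0 < W" and a: "0 \<le> a"
  shows "\<exists>C>0. \<forall>h t. antimono h \<longrightarrow> 0 < t \<longrightarrow> t < 1 \<longrightarrow> h t \<le> ennreal C * Hup a W d h t"
proof -
  obtain C where C: "0 < C"
    "\<And>s t. 0 < s \<Longrightarrow> s \<le> t \<Longrightarrow> t < 1 \<Longrightarrow> t powr - 1 * d t \<le> C * (s powr - 1 * d s)"
    using SV_almost_decreasing[OF d, of 1] by auto
  let ?K = "2 powr a * (2 * C)"
  have "h t \<le> ennreal (2 powr recip W * ?K) * Hup a W d h t"
    if h: "antimono h" and t: "0 < t" "t < 1" for h t
    unfolding Hup_def
  proof (rule le_inverse_mult)
    show "0 < t powr a * d t" using t SV_pos[OF d, of t] by simp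
    have "ennreal (t powr a * d t / ?K) * h t
        \<le> ennreal (2 powr recip W) * Mnorm W 0 t (\<lambda>v. ennreal (v powr a * d v) * h v)"
    proof (rule le_Mnorm[OF W])
      fix v assume v: "t / 2 < v" "v < t"
      have "d t = t * (t powr - 1 * d t)"
        using t by (simp add: powr_minus_divide)
      also have "\<dots> \<le> (2 * v) * (C * (v powr - 1 * d v))"
        using v t SV_pos[OF d, of t] by (intro mult_mono[OF _ C(2)]) auto
      also have "\<dots> = 2 * C * d v"
        using v t by (simp add: powr_minus_divide)
      finally have "t powr a * d t \<le> (2 * v) powr a * (2 * C * d v)"
        using v t a C SV_pos[OF d, of t] by (intro mult_mono powr_mono2) auto
      also have "\<dots> = ?K * (v powr a * d v)"
        using v t by (simp add: powr_mult)
      finally have "t powr a * d t / ?K \<le> v powr a * d v"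
        using C by (simp add: divide_le_eq mult.commute)
      moreover have "h t \<le> h v"
        using h v by (auto simp: antimono_def)
      ultimately show "ennreal (t powr a * d t / ?K) * h t \<le> ennreal (v powr a * d v) * h v"
        by (intro mult_mono ennreal_leI) auto
    qed (use t in auto)
    then have "ennreal ?K * (ennreal (t powr a * d t / ?K) * h t)
        \<le> ennreal ?K * (ennreal (2 powr recip W) * Mnorm W 0 t (\<lambda>v. ennreal (v powr a * d v) * h v))"
      by (rule mult_left_mono) simp
    moreover have "ennreal ?K * (ennreal (t powr a * d t / ?K) * h t) = ennreal (t powr a * d t) * h t"
      using C SV_pos[OF d, of t] t by (simp add: ennreal_mult[symmetric] flip: mult.assoc)
    ultimately show "ennreal (t powr a * d t) * h t
        \<le> ennreal (2 powr recip W * ?K) * Mnorm W 0 t (\<lambda>v. ennreal (v powr a * d v) * h v)"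
      using C by (simp add: ennreal_mult ac_simps)
  qed (use C in auto)
  then show ?thesis using C by (intro exI[of _ "2 powr recip W * ?K"]) auto
qed

text \<open>The average at \<open>t\<close> sees only values of \<open>h\<close> to the right of
  \<open>t\<close>, which may be much smaller than \<open>h t\<close>. Starting it at
  \<open>t / 2\<close> brings in the interval \<open>(t / 2, t)\<close>, where
  \<open>h \<ge> h t\<close>.\<close>

lemma Hlow_ge:
  assumes d: "d \<in> SV" and W: "0 < W" and a: "0 \<le> a"
  shows "\<exists>C>0. \<forall>h t. antimono h \<longrightarrow> 0 < t \<longrightarrow> t < 1 \<longrightarrow> h t \<le> ennreal C * Hlow a W d h (t / 2)"
proof -
  obtain C where C: "0 < C"
    "\<And>s t. 0 < s \<Longrightarrow> s \<le> t \<Longrightarrow> t < 1 \<Longrightarrow> s powr 1 * d s \<le> C * (t powr 1 * d t)"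
    using SV_almost_increasing[OF d, of 1] by auto
  have "h t \<le> ennreal (2 powr recip W * (2 * C)) * Hlow a W d h (t / 2)"
    if h: "antimono h" and t: "0 < t" "t < 1" for h t
    unfolding Hlow_def
  proof (rule le_inverse_mult)
    show "0 < (t / 2) powr a * d (t / 2)" using t SV_pos[OF d, of "t / 2"] by simp
    have "ennreal ((t / 2) powr a * d (t / 2) / (2 * C)) * h t
        \<le> ennreal (2 powr recip W) * Mnorm W (t / 2) 1 (\<lambda>v. ennreal (v powr a * d v) * h v)"
    proof (rule le_Mnorm[OF W])
      fix v assume v: "t / 2 < v" "v < t"
      have "d (t / 2) = ((t / 2) powr 1 * d (t / 2)) * 2 / t"
        using t by simp
      also have "\<dots> \<le> (C * (v powr 1 * d v)) * 2 / t"
        using C(2)[of "t / 2" v] v t by (intro divide_right_mono mult_right_mono) simp_all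
      also have "\<dots> = 2 * C * d v * (v / t)"
        using v t by simp
      also have "\<dots> \<le> 2 * C * d v * 1"
        using v t C SV_pos[OF d, of v] by (intro mult_left_mono) auto
      finally have "(t / 2) powr a * d (t / 2) \<le> v powr a * (2 * C * d v)"
        using v t a C SV_pos[OF d, of "t / 2"] by (intro mult_mono powr_mono2) auto
      then have "(t / 2) powr a * d (t / 2) / (2 * C) \<le> v powr a * d v"
        using C by (simp add: divide_le_eq ac_simps)
      moreover have "h t \<le> h v"
        using h v by (auto simp: antimono_def)
      ultimately show "ennreal ((t / 2) powr a * d (t / 2) / (2 * C)) * h t \<le> ennreal (v powr a * d v) * h v"
        by (intro mult_mono ennreal_leI) auto
    qed (use t in auto)
    then have "ennreal (2 * C) * (ennreal ((t / 2) powr a * d (t / 2) / (2 * C)) * h t)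
        \<le> ennreal (2 * C) * (ennreal (2 powr recip W) * Mnorm W (t / 2) 1 (\<lambda>v. ennreal (v powr a * d v) * h v))"
      by (rule mult_left_mono) simp
    moreover have "ennreal (2 * C) * (ennreal ((t / 2) powr a * d (t / 2) / (2 * C)) * h t)
        = ennreal ((t / 2) powr a * d (t / 2)) * h t"
      using C SV_pos[OF d, of "t / 2"] t by (simp add: ennreal_mult[symmetric] flip: mult.assoc)
    ultimately show "ennreal ((t / 2) powr a * d (t / 2)) * h t
        \<le> ennreal (2 powr recip W * (2 * C)) * Mnorm W (t / 2) 1 (\<lambda>v. ennreal (v powr a * d v) * h v)"
      using C by (simp add: ennreal_mult ac_simps)
  qed (use C in auto)
  then show ?thesis using C by (intro exI[of _ "2 powr recip W * (2 * C)"]) auto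
qed

lemma powr_mult_le_Mnorm:
  assumes q: "0 < q" and h: "antimono h" and v: "0 < v" "l \<le> v / 2" "v \<le> m" and \<beta>: "0 \<le> \<beta>"
  shows "ennreal (v powr \<beta>) * h v
    \<le> ennreal (2 powr (\<beta> + recip q)) * Mnorm q l m (\<lambda>x. ennreal (x powr \<beta>) * h x)"
proof -
  have "ennreal ((v / 2) powr \<beta>) * h v
      \<le> ennreal (2 powr recip q) * Mnorm q l m (\<lambda>x. ennreal (x powr \<beta>) * h x)"
    using v h \<beta> by (intro le_Mnorm[OF q]) (auto simp: antimono_def intro!: mult_mono ennreal_leI powr_mono2)
  then have "ennreal (2 powr \<beta>) * (ennreal ((v / 2) powr \<beta>) * h v)
      \<le> ennreal (2 powr \<beta>) * (ennreal (2 powr recip q) * Mnorm q l m (\<lambda>x. ennreal (x powr \<beta>) * h x))"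
    by (rule mult_left_mono) simp
  moreover have "ennreal (2 powr \<beta>) * (ennreal ((v / 2) powr \<beta>) * h v) = ennreal (v powr \<beta>) * h v"
    using v by (simp add: ennreal_mult[symmetric] powr_divide flip: mult.assoc)
  ultimately show ?thesis
    by (simp add: powr_add ennreal_mult mult.assoc)
qed

text \<open>Half of the gap \<open>a - \<beta>\<close> makes \<open>v powr \<epsilon> * d v\<close>
  almost increasing, which removes \<open>d\<close>; the other half makes the \<open>W\<close>-norm
  of \<open>v powr \<epsilon>\<close> converge at \<open>0\<close>. The remaining
  \<open>v powr \<beta> * h v\<close> is bounded by the \<open>q\<close>-norm, so \<open>W\<close>
  and \<open>q\<close> need not be related.\<close>

lemma Hup_le:
  assumes d: "d \<in> SV" and W: "0 < W" and q: "0 < q" and \<beta>: "0 \<le> \<beta>" "\<beta> < a"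
  shows "\<exists>C>0. \<forall>h t. antimono h \<longrightarrow> 0 < t \<longrightarrow> t < 1 \<longrightarrow>
    Hup a W d h t \<le> ennreal (C * t powr - \<beta>) * Mnorm q 0 t (\<lambda>x. ennreal (x powr \<beta>) * h x)"
proof -
  define \<epsilon> where "\<epsilon> = (a - \<beta>) / 2"
  have \<epsilon>: "0 < \<epsilon>" "a = \<epsilon> + \<epsilon> + \<beta>" using \<beta> by (simp_all add: \<epsilon>_def)
  obtain C1 where C1: "0 < C1"
    "\<And>s t. 0 < s \<Longrightarrow> s \<le> t \<Longrightarrow> t < 1 \<Longrightarrow> s powr \<epsilon> * d s \<le> C1 * (t powr \<epsilon> * d t)"
    using SV_almost_increasing[OF d \<epsilon>(1)] by auto
  obtain C2 where C2: "0 < C2" "\<And>t. 0 < t \<Longrightarrow> Mnorm W 0 t (\<lambda>x. ennreal (x powr \<epsilon>)) \<le> ennreal (C2 * t powr \<epsilon>)"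
    using Mnorm_powr_le[OF W \<epsilon>(1)] by auto
  let ?K = "2 powr (\<beta> + recip q)"
  have "Hup a W d h t \<le> ennreal (C1 * C2 * ?K * t powr - \<beta>) * Mnorm q 0 t (\<lambda>x. ennreal (x powr \<beta>) * h x)"
    if h: "antimono h" and t: "0 < t" "t < 1" for h t
  proof -
    define S where "S = Mnorm q 0 t (\<lambda>x. ennreal (x powr \<beta>) * h x)"
    define D where "D = C1 * (t powr \<epsilon> * d t)"
    have D: "0 \<le> D" using C1 SV_pos[OF d, of t] t by (simp add: D_def)
    have "Mnorm W 0 t (\<lambda>v. ennreal (v powr a * d v) * h v)
        \<le> (ennreal (D * ?K) * S) * Mnorm W 0 t (\<lambda>v. ennreal (v powr \<epsilon>))"
    proof (rule Mnorm_le_cmult[OF W measurable_SV_weight[OF d h] borel_measurable_lebesgue_on])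
      fix v assume v: "0 < v" "v < t"
      have "v powr a * d v = (v powr \<epsilon> * d v) * (v powr \<epsilon> * v powr \<beta>)"
        by (simp only: \<epsilon>(2) powr_add ac_simps)
      also have "\<dots> \<le> D * (v powr \<epsilon> * v powr \<beta>)"
        using C1(2)[of v t] v t by (intro mult_right_mono) (auto simp: D_def)
      finally have "ennreal (v powr a * d v) * h v \<le> ennreal (D * (v powr \<epsilon> * v powr \<beta>)) * h v"
        by (intro mult_right_mono ennreal_leI) auto
      also have "\<dots> = ennreal D * ennreal (v powr \<epsilon>) * (ennreal (v powr \<beta>) * h v)"
        using D by (simp add: ennreal_mult ac_simps)
      also have "\<dots> \<le> ennreal D * ennreal (v powr \<epsilon>) * (ennreal ?K * S)"
        unfolding S_def using v t h \<beta> by (intro mult_left_mono powr_mult_le_Mnorm[OF q]) auto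
      finally show "ennreal (v powr a * d v) * h v \<le> (ennreal (D * ?K) * S) * ennreal (v powr \<epsilon>)"
        using D by (simp add: ennreal_mult ac_simps)
    qed (use t in auto)
    also have "\<dots> \<le> (ennreal (D * ?K) * S) * ennreal (C2 * t powr \<epsilon>)"
      using C2(2) t by (intro mult_left_mono) auto
    finally have "Hup a W d h t
        \<le> ennreal (inverse (t powr a * d t)) * ((ennreal (D * ?K) * S) * ennreal (C2 * t powr \<epsilon>))"
      unfolding Hup_def by (rule mult_left_mono) simp
    also have "\<dots> = ennreal (inverse (t powr a * d t) * (D * ?K) * (C2 * t powr \<epsilon>)) * S"
      using D C2(1) SV_pos[OF d, of t] t by (simp add: ennreal_mult ac_simps)
    \<comment> \<open>Both halves \<open>t powr \<epsilon>\<close> and the factor \<open>d t\<close>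
      cancel, leaving \<open>t powr - \<beta>\<close> from \<open>t powr - a\<close>.\<close>
    also have "inverse (t powr a * d t) * (D * ?K) * (C2 * t powr \<epsilon>) = C1 * C2 * ?K * t powr - \<beta>"
      using SV_pos[OF d, of t] t unfolding D_def \<epsilon>(2) powr_add[of t]
      by (simp add: powr_minus divide_simps)
    finally show ?thesis unfolding S_def .
  qed
  then show ?thesis using C1(1) C2(1) by (intro exI[of _ "C1 * C2 * ?K"]) auto
qed

text \<open>Mirror image of the bound for \<open>Hup\<close>, with \<open>- \<epsilon>\<close> for
  \<open>\<epsilon>\<close>. The norm starts at \<open>t / 2\<close> because
  \<open>v powr \<beta> * h v\<close> is estimated over \<open>(v / 2, v)\<close>, which for
  \<open>v\<close> near \<open>t\<close> reaches to the left of \<open>t\<close>.\<close>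

lemma Hlow_le:
  assumes d: "d \<in> SV" and W: "0 < W" and q: "0 < q" and \<beta>: "0 \<le> \<beta>" "a < \<beta>"
  shows "\<exists>C>0. \<forall>h t. antimono h \<longrightarrow> 0 < t \<longrightarrow> t < 1 \<longrightarrow>
    Hlow a W d h t \<le> ennreal (C * t powr - \<beta>) * Mnorm q (t / 2) 1 (\<lambda>x. ennreal (x powr \<beta>) * h x)"
proof -
  define \<epsilon> where "\<epsilon> = (\<beta> - a) / 2"
  have \<epsilon>: "0 < \<epsilon>" "a = - \<epsilon> + - \<epsilon> + \<beta>" using \<beta> by (simp_all add: \<epsilon>_def)
  obtain C1 where C1: "0 < C1"
    "\<And>s t. 0 < s \<Longrightarrow> s \<le> t \<Longrightarrow> t < 1 \<Longrightarrow> t powr - \<epsilon> * d t \<le> C1 * (s powr - \<epsilon> * d s)"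
    using SV_almost_decreasing[OF d \<epsilon>(1)] by auto
  obtain C2 where C2: "0 < C2" "\<And>t T. 0 < t \<Longrightarrow> Mnorm W t T (\<lambda>x. ennreal (x powr - \<epsilon>)) \<le> ennreal (C2 * t powr - \<epsilon>)"
    using Mnorm_powr_neg_le[OF W \<epsilon>(1)] by auto
  let ?K = "2 powr (\<beta> + recip q)"
  have "Hlow a W d h t \<le> ennreal (C1 * C2 * ?K * t powr - \<beta>) * Mnorm q (t / 2) 1 (\<lambda>x. ennreal (x powr \<beta>) * h x)"
    if h: "antimono h" and t: "0 < t" "t < 1" for h t
  proof -
    define S where "S = Mnorm q (t / 2) 1 (\<lambda>x. ennreal (x powr \<beta>) * h x)"
    define D where "D = C1 * (t powr - \<epsilon> * d t)"
    have D: "0 \<le> D" using C1 SV_pos[OF d, of t] t by (simp add: D_def)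
    have "Mnorm W t 1 (\<lambda>v. ennreal (v powr a * d v) * h v)
        \<le> (ennreal (D * ?K) * S) * Mnorm W t 1 (\<lambda>v. ennreal (v powr - \<epsilon>))"
    proof (rule Mnorm_le_cmult[OF W measurable_SV_weight[OF d h] borel_measurable_lebesgue_on])
      fix v assume v: "t < v" "v < 1"
      have "v powr a * d v = (v powr - \<epsilon> * d v) * (v powr - \<epsilon> * v powr \<beta>)"
        by (simp only: \<epsilon>(2) powr_add) simp
      also have "\<dots> \<le> D * (v powr - \<epsilon> * v powr \<beta>)"
        using C1(2)[of t v] v t by (intro mult_right_mono) (auto simp: D_def)
      finally have "ennreal (v powr a * d v) * h v \<le> ennreal (D * (v powr - \<epsilon> * v powr \<beta>)) * h v"
        by (intro mult_right_mono ennreal_leI) auto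
      also have "\<dots> = ennreal D * ennreal (v powr - \<epsilon>) * (ennreal (v powr \<beta>) * h v)"
        using D by (simp add: ennreal_mult ac_simps)
      also have "\<dots> \<le> ennreal D * ennreal (v powr - \<epsilon>) * (ennreal ?K * S)"
        unfolding S_def using v t h \<beta> by (intro mult_left_mono powr_mult_le_Mnorm[OF q]) auto
      finally show "ennreal (v powr a * d v) * h v \<le> (ennreal (D * ?K) * S) * ennreal (v powr - \<epsilon>)"
        using D by (simp add: ennreal_mult ac_simps)
    qed (use t in auto)
    also have "\<dots> \<le> (ennreal (D * ?K) * S) * ennreal (C2 * t powr - \<epsilon>)"
      using C2(2) t by (intro mult_left_mono) auto
    finally have "Hlow a W d h t
        \<le> ennreal (inverse (t powr a * d t)) * ((ennreal (D * ?K) * S) * ennreal (C2 * t powr - \<epsilon>))"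
      unfolding Hlow_def by (rule mult_left_mono) simp
    also have "\<dots> = ennreal (inverse (t powr a * d t) * (D * ?K) * (C2 * t powr - \<epsilon>)) * S"
      using D C2(1) SV_pos[OF d, of t] t by (simp add: ennreal_mult ac_simps)
    also have "inverse (t powr a * d t) * (D * ?K) * (C2 * t powr - \<epsilon>) = C1 * C2 * ?K * t powr - \<beta>"
      using SV_pos[OF d, of t] t unfolding D_def \<epsilon>(2) powr_add[of t]
      by (simp add: powr_minus divide_simps)
    finally show ?thesis unfolding S_def .
  qed
  then show ?thesis using C1(1) C2(1) by (intro exI[of _ "C1 * C2 * ?K"]) auto
qed

section \<open>Hardy inequalities\<close>

text \<open>For fixed \<open>x\<close> the variable \<open>u\<close> runs over
  \<open>(x, t)\<close>, where the norm of \<open>u powr - \<gamma>\<close> is at most a multiple of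
  \<open>x powr - \<gamma>\<close>; this cancels the inner weight.\<close>

lemma Hardy_lower_limit_0:
  assumes q: "0 < q" and \<gamma>: "0 < \<gamma>"
  shows "\<exists>C>0. \<forall>g t. g \<in> borel_measurable borel \<longrightarrow>
    Mnorm q 0 t (\<lambda>u. ennreal (u powr - \<gamma>) * Mnorm q 0 u (\<lambda>x. ennreal (x powr \<gamma>) * g x))
      \<le> ennreal C * Mnorm q 0 t g"
proof -
  obtain C where C: "0 < C" "\<And>t T. 0 < t \<Longrightarrow> Mnorm q t T (\<lambda>x. ennreal (x powr - \<gamma>)) \<le> ennreal (C * t powr - \<gamma>)"
    using Mnorm_powr_neg_le[OF q \<gamma>] by auto
  have "Mnorm q 0 t (\<lambda>u. ennreal (u powr - \<gamma>) * Mnorm q 0 u (\<lambda>x. ennreal (x powr \<gamma>) * g x))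
      \<le> ennreal C * Mnorm q 0 t g" if [measurable]: "g \<in> borel_measurable borel" for g t
  proof -
    have "mono (\<lambda>u. Mnorm q 0 u (\<lambda>x. ennreal (x powr \<gamma>) * g x))"
      by (auto simp: mono_def intro!: Mnorm_subinterval q)
    then have [measurable]: "(\<lambda>u. Mnorm q 0 u (\<lambda>x. ennreal (x powr \<gamma>) * g x)) \<in> borel_measurable borel"
      by (intro borel_measurable_monotone) simp
    have "Mnorm q 0 t (\<lambda>u. ennreal (u powr - \<gamma>) * Mnorm q 0 u (\<lambda>x. ennreal (x powr \<gamma>) * g x))
      \<le> Mnorm q 0 t (\<lambda>x. ennreal (C * x powr - \<gamma>) * (ennreal (x powr \<gamma>) * g x))"
    proof (rule Mnorm_Fubini_le[where l = "\<lambda>_. 0" and m = "\<lambda>u. u"])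
      fix x assume x: "0 < x" "x < t"
      have "Mnorm q 0 t (\<lambda>u. ennreal (u powr - \<gamma>) * indicator {0<..<u} x)
          \<le> Mnorm q x t (\<lambda>u. ennreal (u powr - \<gamma>))"
      proof (rule Mnorm_le[OF q])
        have "(\<lambda>u. indicator {0<..<u} x :: ennreal) \<in> borel_measurable borel"
          unfolding indicator_def of_bool_def greaterThanLessThan_iff by measurable
        then show "(\<lambda>u. ennreal (u powr - \<gamma>) * indicator {0<..<u} x) \<in> borel_measurable (lebesgue_on {0<..<t})"
          by (intro borel_measurable_lebesgue_on borel_measurable_times_ennreal) (simp, assumption)
      qed (auto simp: indicator_def)
      also have "\<dots> \<le> ennreal (C * x powr - \<gamma>)"
        using C(2) x by auto
      finally show "Mnorm q 0 t (\<lambda>u. ennreal (u powr - \<gamma>) * indicator {0<..<u} x) \<le> ennreal (C * x powr - \<gamma>)" .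
    qed (auto simp: q)
    also have "\<dots> \<le> ennreal C * Mnorm q 0 t g"
    proof (rule Mnorm_le_cmult[OF q])
      fix x assume x: "0 < x" "x < t"
      have "ennreal (C * x powr - \<gamma>) * ennreal (x powr \<gamma>) = ennreal C"
        using x C(1) by (simp add: ennreal_mult[symmetric] powr_minus)
      then show "ennreal (C * x powr - \<gamma>) * (ennreal (x powr \<gamma>) * g x) \<le> ennreal C * g x"
        by (simp flip: mult.assoc)
    qed (auto intro!: borel_measurable_lebesgue_on)
    finally show ?thesis .
  qed
  then show ?thesis using C(1) by auto
qed

text \<open>For fixed \<open>x\<close> the variable \<open>u\<close> runs over
  \<open>(0, min T (2 * x))\<close>. The minimum is kept because for \<open>x > T\<close> the
  bounded factor \<open>T powr \<eta>\<close> supplies decay in \<open>x\<close> relative to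
  \<open>x powr \<eta>\<close>. The weight is left general to serve twice: a pure power with
  \<open>\<phi> = 1\<close> for the inner \<open>q\<close>-norm, and a power times \<open>b'\<close>
  for the outer \<open>r\<close>-norm.\<close>

lemma Hardy_upper_limit_1:
  assumes q: "0 < q" and \<eta>: "0 < \<eta>"
  obtains C where "0 < C"
    "\<And>T A k w \<phi>. k \<in> borel_measurable borel \<Longrightarrow> w \<in> borel_measurable borel \<Longrightarrow> \<phi> \<in> borel_measurable borel \<Longrightarrow>
      0 < T \<Longrightarrow> T \<le> 1 \<Longrightarrow> 0 \<le> A \<Longrightarrow> (\<And>x. 0 \<le> \<phi> x) \<Longrightarrow>
      (\<And>u x. 0 < u \<Longrightarrow> u < T \<Longrightarrow> 0 < x \<Longrightarrow> x < 1 \<Longrightarrow> u < 2 * x \<Longrightarrow> w u \<le> A * \<phi> x * u powr \<eta>) \<Longrightarrow>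
      Mnorm q 0 T (\<lambda>u. ennreal (w u) * Mnorm q (u / 2) 1 k)
        \<le> ennreal (A * C) * Mnorm q 0 1 (\<lambda>x. ennreal (min T (2 * x) powr \<eta> * \<phi> x) * k x)"
proof -
  obtain C where C: "0 < C" "\<And>t. 0 < t \<Longrightarrow> Mnorm q 0 t (\<lambda>x. ennreal (x powr \<eta>)) \<le> ennreal (C * t powr \<eta>)"
    using Mnorm_powr_le[OF q \<eta>] by auto
  show thesis
  proof (rule that[OF C(1)])
    fix T A :: real and k :: "real \<Rightarrow> ennreal" and w \<phi> :: "real \<Rightarrow> real"
    assume [measurable]: "k \<in> borel_measurable borel" "w \<in> borel_measurable borel" "\<phi> \<in> borel_measurable borel"
      and T: "0 < T" "T \<le> 1" and A: "0 \<le> A" and \<phi>: "\<And>x. 0 \<le> \<phi> x"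
      and w: "\<And>u x. 0 < u \<Longrightarrow> u < T \<Longrightarrow> 0 < x \<Longrightarrow> x < 1 \<Longrightarrow> u < 2 * x \<Longrightarrow> w u \<le> A * \<phi> x * u powr \<eta>"
    have "antimono (\<lambda>u. Mnorm q (u / 2) 1 k)"
      by (auto simp: antimono_def intro!: Mnorm_subinterval q)
    then have [measurable]: "(\<lambda>u. Mnorm q (u / 2) 1 k) \<in> borel_measurable borel"
      by (intro borel_measurable_monotone) simp
    have "Mnorm q 0 T (\<lambda>u. ennreal (w u) * Mnorm q (u / 2) 1 k)
        \<le> Mnorm q 0 1 (\<lambda>x. ennreal (A * \<phi> x * (C * min T (2 * x) powr \<eta>)) * k x)"
    proof (rule Mnorm_Fubini_le[where l = "\<lambda>u. u / 2" and m = "\<lambda>_. 1"])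
      fix x :: real assume x: "0 < x" "x < 1"
      have "Mnorm q 0 T (\<lambda>u. ennreal (w u) * indicator {u / 2<..<1} x)
          \<le> Mnorm q 0 (min T (2 * x)) (\<lambda>u. ennreal (A * \<phi> x) * ennreal (u powr \<eta>))"
      proof (rule Mnorm_le[OF q])
        have "(\<lambda>u. indicator {u / 2<..<1} x :: ennreal) \<in> borel_measurable borel"
          unfolding indicator_def of_bool_def greaterThanLessThan_iff by measurable
        then show "(\<lambda>u. ennreal (w u) * indicator {u / 2<..<1} x) \<in> borel_measurable (lebesgue_on {0<..<T})"
          by (intro borel_measurable_lebesgue_on borel_measurable_times_ennreal) (simp, assumption)
        fix u assume "0 < u" "u < T" "u < min T (2 * x)"
        then have "ennreal (w u) \<le> ennreal (A * \<phi> x) * ennreal (u powr \<eta>)"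
          using w[of u x] x A \<phi>[of x] by (auto simp: ennreal_mult[symmetric] intro!: ennreal_leI)
        then show "ennreal (w u) * indicator {u / 2<..<1} x \<le> ennreal (A * \<phi> x) * ennreal (u powr \<eta>)"
          by (auto simp: indicator_def)
      qed (auto simp: indicator_def)
      also have "\<dots> \<le> ennreal (A * \<phi> x) * Mnorm q 0 (min T (2 * x)) (\<lambda>u. ennreal (u powr \<eta>))"
        by (intro Mnorm_cmult_le q borel_measurable_lebesgue_on) simp
      also have "\<dots> \<le> ennreal (A * \<phi> x) * ennreal (C * min T (2 * x) powr \<eta>)"
        using x T by (intro mult_left_mono C(2)) auto
      finally show "Mnorm q 0 T (\<lambda>u. ennreal (w u) * indicator {u / 2<..<1} x)
          \<le> ennreal (A * \<phi> x * (C * min T (2 * x) powr \<eta>))"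
        using A \<phi>[of x] C(1) by (simp add: ennreal_mult)
    qed (auto simp: q)
    also have "\<dots> \<le> ennreal (A * C) * Mnorm q 0 1 (\<lambda>x. ennreal (min T (2 * x) powr \<eta> * \<phi> x) * k x)"
    proof (rule Mnorm_le_cmult[OF q])
      fix x :: real
      show "ennreal (A * \<phi> x * (C * min T (2 * x) powr \<eta>)) * k x
          \<le> ennreal (A * C) * (ennreal (min T (2 * x) powr \<eta> * \<phi> x) * k x)"
        using A C(1) \<phi>[of x] by (simp add: ennreal_mult ac_simps)
    qed (auto intro!: borel_measurable_lebesgue_on)
    finally show "Mnorm q 0 T (\<lambda>u. ennreal (w u) * Mnorm q (u / 2) 1 k)
        \<le> ennreal (A * C) * Mnorm q 0 1 (\<lambda>x. ennreal (min T (2 * x) powr \<eta> * \<phi> x) * k x)" .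
  qed
qed

text \<open>Monotonicity gives \<open>h x \<le> h (x / 2)\<close>, and the dilation by
  \<open>2\<close> turns the right side into a norm over \<open>(0, t / 2)\<close>.\<close>

lemma Mnorm_doubling:
  assumes q: "0 < q" and \<alpha>: "0 \<le> \<alpha>" and h: "antimono h"
  shows "Mnorm q 0 t (\<lambda>x. ennreal (x powr \<alpha>) * h x)
    \<le> ennreal (2 powr \<alpha>) * Mnorm q 0 (t / 2) (\<lambda>x. ennreal (x powr \<alpha>) * h x)"
proof -
  have [measurable]: "h \<in> borel_measurable borel"
    using h by (intro borel_measurable_monotone) simp
  have "Mnorm q 0 t (\<lambda>x. ennreal (x powr \<alpha>) * h x)
      \<le> ennreal (2 powr \<alpha>) * Mnorm q 0 t (\<lambda>x. ennreal ((x / 2) powr \<alpha>) * h (x / 2))"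
  proof (rule Mnorm_le_cmult[OF q])
    fix x :: real assume x: "0 < x"
    have "ennreal (x powr \<alpha>) * h x \<le> ennreal (x powr \<alpha>) * h (x / 2)"
      using h x by (intro mult_left_mono) (auto simp: antimono_def)
    moreover have "ennreal (x powr \<alpha>) = ennreal (2 powr \<alpha>) * ennreal ((x / 2) powr \<alpha>)"
      using x by (simp add: ennreal_mult[symmetric] powr_divide)
    ultimately show "ennreal (x powr \<alpha>) * h x \<le> ennreal (2 powr \<alpha>) * (ennreal ((x / 2) powr \<alpha>) * h (x / 2))"
      by (metis mult.assoc)
  qed (auto intro!: borel_measurable_lebesgue_on)
  also have "\<dots> \<le> ennreal (2 powr \<alpha>) * Mnorm q 0 (t / 2) (\<lambda>x. ennreal (x powr \<alpha>) * h x)"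
    by (intro mult_left_mono Mnorm_dilate_le[OF q, of "\<lambda>x. ennreal (x powr \<alpha>) * h x"]) auto
  finally show ?thesis .
qed

text \<open>Passing to the \<open>r\<close>-norm over \<open>(t / 2, 1)\<close> absorbs the part of the lower average that lies to
  the right of \<open>t\<close>, which no norm over \<open>(0, t)\<close> can control.\<close>

lemma inner_lower_average_le:
  assumes q: "0 < q" and r: "0 < r" and \<alpha>: "0 \<le> \<alpha>" and \<gamma>: "0 < \<delta>" "\<delta> < \<gamma>" "\<gamma> \<le> \<alpha>"
  shows "\<exists>C>0. \<forall>h t. antimono h \<longrightarrow> 0 < t \<longrightarrow> t < 1 \<longrightarrow>
    Mnorm q 0 t (\<lambda>u. ennreal (u powr \<gamma>) * Mnorm q (u / 2) 1 (\<lambda>x. ennreal (x powr (\<alpha> - \<gamma>)) * h x))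
    \<le> ennreal (C * t powr \<delta>) *
      Mnorm r (t / 2) 1 (\<lambda>y. ennreal (y powr - \<delta>) * Mnorm q 0 y (\<lambda>x. ennreal (x powr \<alpha>) * h x))"
proof (rule Hardy_upper_limit_1[OF q order_less_trans[OF \<gamma>(1,2)]], goal_cases)
  case (1 C1)
  note C1 = 1(1) and Hardy = 1(2)
  obtain C2 where C2: "0 < C2"
    "\<And>t T. 0 < t \<Longrightarrow> Mnorm q t T (\<lambda>x. ennreal (x powr - (\<gamma> - \<delta>))) \<le> ennreal (C2 * t powr - (\<gamma> - \<delta>))"
    using Mnorm_powr_neg_le[OF q, of "\<gamma> - \<delta>"] \<gamma> by auto
  \<comment> \<open>In \<open>K\<close>, \<open>2 powr recip r\<close> is the price of bounding a
    value by an \<open>r\<close>-norm and \<open>2 powr \<alpha>\<close> that of doubling;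
    \<open>L\<close> is the price of bounding \<open>x powr \<alpha> * h x\<close> by a
    \<open>q\<close>-norm.\<close>
  define K where "K = 2 powr recip r * 2 powr \<alpha>"
  define L where "L = 2 powr (\<alpha> + recip q)"
  have K: "0 < K" and L: "0 < L" by (simp_all add: K_def L_def)
  let ?C = "C1 * 2 powr recip q * (2 powr \<gamma> * K + L * K * C2)"
  have "Mnorm q 0 t (\<lambda>u. ennreal (u powr \<gamma>) * Mnorm q (u / 2) 1 (\<lambda>x. ennreal (x powr (\<alpha> - \<gamma>)) * h x))
      \<le> ennreal (?C * t powr \<delta>) *
        Mnorm r (t / 2) 1 (\<lambda>y. ennreal (y powr - \<delta>) * Mnorm q 0 y (\<lambda>x. ennreal (x powr \<alpha>) * h x))"
    if h: "antimono h" and t: "0 < t" "t < 1" for h t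
  proof -
    have [measurable]: "h \<in> borel_measurable borel"
      using h by (intro borel_measurable_monotone) simp
    define N where "N y = Mnorm q 0 y (\<lambda>x. ennreal (x powr \<alpha>) * h x)" for y
    have N_mono: "N x \<le> N y" if "x \<le> y" for x y
      using that by (auto simp: N_def intro!: Mnorm_subinterval q)
    define R where "R = Mnorm r (t / 2) 1 (\<lambda>y. ennreal (y powr - \<delta>) * N y)"
    \<comment> \<open>On \<open>(v / 2, v)\<close> the integrand of \<open>R\<close> is at least
      \<open>v powr - \<delta> * N (v / 2)\<close>, and doubling returns from
      \<open>N (v / 2)\<close> to \<open>N v\<close>. The interval lies in the domain of
      \<open>R\<close> because \<open>t \<le> v\<close>.\<close>
    have N_le: "N v \<le> ennreal (K * v powr \<delta>) * R" if v: "t \<le> v" "v < 1" for v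
    proof -
      have "ennreal (v powr - \<delta>) * N (v / 2) \<le> ennreal (2 powr recip r) * R"
        unfolding R_def using v t \<gamma>
        by (intro le_Mnorm[OF r, of v]) (auto intro!: mult_mono ennreal_leI powr_mono2' N_mono)
      then have le: "ennreal (v powr \<delta> * 2 powr \<alpha>) * (ennreal (v powr - \<delta>) * N (v / 2))
          \<le> ennreal (v powr \<delta> * 2 powr \<alpha>) * (ennreal (2 powr recip r) * R)"
        by (rule mult_left_mono) simp
      have eq: "ennreal (v powr \<delta> * 2 powr \<alpha>) * ennreal (v powr - \<delta>) = ennreal (2 powr \<alpha>)"
        using v t by (simp add: ennreal_mult[symmetric] powr_minus)
      have "N v \<le> ennreal (2 powr \<alpha>) * N (v / 2)"
        unfolding N_def by (rule Mnorm_doubling[OF q \<alpha> h])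
      also have "\<dots> = ennreal (v powr \<delta> * 2 powr \<alpha>) * (ennreal (v powr - \<delta>) * N (v / 2))"
        by (simp only: mult.assoc[symmetric] eq)
      also note le
      also have "ennreal (v powr \<delta> * 2 powr \<alpha>) * (ennreal (2 powr recip r) * R) = ennreal (K * v powr \<delta>) * R"
        by (simp add: K_def ennreal_mult ac_simps)
      finally show ?thesis .
    qed
    let ?k = "\<lambda>x. ennreal (x powr (\<alpha> - \<gamma>)) * h x"
    let ?G = "\<lambda>x. ennreal (min t (2 * x) powr \<gamma>) * ?k x"
    have "Mnorm q 0 t (\<lambda>u. ennreal (u powr \<gamma>) * Mnorm q (u / 2) 1 ?k)
        \<le> ennreal (1 * C1) * Mnorm q 0 1 (\<lambda>x. ennreal (min t (2 * x) powr \<gamma> * 1) * ?k x)"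
      using t by (intro Hardy) auto
    then have whole: "Mnorm q 0 t (\<lambda>u. ennreal (u powr \<gamma>) * Mnorm q (u / 2) 1 ?k)
        \<le> ennreal C1 * Mnorm q 0 1 ?G"
      by simp
    have split: "Mnorm q 0 1 ?G \<le> ennreal (2 powr recip q) * (Mnorm q 0 t ?G + Mnorm q t 1 ?G)"
      by (rule Mnorm_split[OF q]) simp
    \<comment> \<open>To the left of \<open>t\<close>, estimating the minimum by
      \<open>2 * x\<close> restores the weight \<open>x powr \<alpha>\<close>, and the norm is just
      \<open>N t\<close>.\<close>
    have left: "Mnorm q 0 t ?G \<le> ennreal (2 powr \<gamma> * K * t powr \<delta>) * R"
    proof -
      have "Mnorm q 0 t ?G \<le> ennreal (2 powr \<gamma>) * N t"
        unfolding N_def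
      proof (rule Mnorm_le_cmult[OF q])
        fix x assume x: "0 < x" "x < t"
        have "min t (2 * x) powr \<gamma> * x powr (\<alpha> - \<gamma>) \<le> (2 * x) powr \<gamma> * x powr (\<alpha> - \<gamma>)"
          using x t \<gamma> by (intro mult_right_mono powr_mono2) auto
        also have "\<dots> = 2 powr \<gamma> * x powr \<alpha>"
          using x by (simp add: powr_mult powr_diff)
        finally have "ennreal (min t (2 * x) powr \<gamma> * x powr (\<alpha> - \<gamma>)) * h x \<le> ennreal (2 powr \<gamma> * x powr \<alpha>) * h x"
          by (intro mult_right_mono ennreal_leI) auto
        then show "?G x \<le> ennreal (2 powr \<gamma>) * (ennreal (x powr \<alpha>) * h x)"
          by (simp add: ennreal_mult mult.assoc)
      qed (auto intro!: borel_measurable_lebesgue_on)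
      also have "\<dots> \<le> ennreal (2 powr \<gamma>) * (ennreal (K * t powr \<delta>) * R)"
        using t by (intro mult_left_mono N_le) auto
      finally show ?thesis
        using K by (simp add: ennreal_mult mult.assoc)
    qed
    \<comment> \<open>To the right of \<open>t\<close> the weight is
      \<open>(t / x) powr \<gamma> * x powr \<alpha>\<close>. Bounding
      \<open>x powr \<alpha> * h x\<close> by \<open>N x\<close>, and \<open>N x\<close> by
      \<open>x powr \<delta> * R\<close>, leaves \<open>x powr - (\<gamma> - \<delta>)\<close>,
      whose norm is finite because \<open>\<delta> < \<gamma>\<close>.\<close>
    have right: "Mnorm q t 1 ?G \<le> ennreal (L * K * C2 * t powr \<delta>) * R"
    proof -
      have "Mnorm q t 1 ?G \<le> (ennreal (t powr \<gamma> * L * K) * R) * Mnorm q t 1 (\<lambda>x. ennreal (x powr - (\<gamma> - \<delta>)))"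
      proof (rule Mnorm_le_cmult[OF q])
        fix x assume x: "t < x" "x < 1"
        have "min t (2 * x) powr \<gamma> * x powr (\<alpha> - \<gamma>) = t powr \<gamma> * x powr - \<gamma> * x powr \<alpha>"
          using x t by (simp add: min_def powr_diff powr_minus divide_inverse)
        then have "?G x = ennreal (t powr \<gamma> * x powr - \<gamma> * x powr \<alpha>) * h x"
          by (simp add: mult.assoc[symmetric] ennreal_mult[symmetric])
        also have "\<dots> = ennreal (t powr \<gamma> * x powr - \<gamma>) * (ennreal (x powr \<alpha>) * h x)"
          by (simp add: ennreal_mult mult.assoc)
        also have "\<dots> \<le> ennreal (t powr \<gamma> * x powr - \<gamma>) * (ennreal L * N x)"
          unfolding N_def L_def using x t h \<alpha> by (intro mult_left_mono powr_mult_le_Mnorm[OF q]) auto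
        also have "\<dots> \<le> ennreal (t powr \<gamma> * x powr - \<gamma>) * (ennreal L * (ennreal (K * x powr \<delta>) * R))"
          using x by (intro mult_left_mono N_le) auto
        also have "\<dots> = ennreal (t powr \<gamma> * x powr - \<gamma> * L * (K * x powr \<delta>)) * R"
          using K L by (simp add: ennreal_mult mult.assoc)
        also have "t powr \<gamma> * x powr - \<gamma> * L * (K * x powr \<delta>) = t powr \<gamma> * L * K * x powr - (\<gamma> - \<delta>)"
          by (simp add: powr_diff powr_minus divide_inverse)
        also have "ennreal (t powr \<gamma> * L * K * x powr - (\<gamma> - \<delta>)) * R
            = (ennreal (t powr \<gamma> * L * K) * R) * ennreal (x powr - (\<gamma> - \<delta>))"
          using K L by (simp add: ennreal_mult ac_simps)
        finally show "?G x \<le> (ennreal (t powr \<gamma> * L * K) * R) * ennreal (x powr - (\<gamma> - \<delta>))" .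
      qed (auto intro!: borel_measurable_lebesgue_on)
      also have "\<dots> \<le> (ennreal (t powr \<gamma> * L * K) * R) * ennreal (C2 * t powr - (\<gamma> - \<delta>))"
        using t by (intro mult_left_mono C2(2)) auto
      also have "\<dots> = ennreal (t powr \<gamma> * L * K * (C2 * t powr - (\<gamma> - \<delta>))) * R"
        using K L C2(1) by (simp add: ennreal_mult ac_simps)
      also have "t powr \<gamma> * L * K * (C2 * t powr - (\<gamma> - \<delta>)) = L * K * C2 * t powr \<delta>"
        using t by (simp add: powr_diff)
      finally show ?thesis .
    qed
    have "Mnorm q 0 t (\<lambda>u. ennreal (u powr \<gamma>) * Mnorm q (u / 2) 1 ?k)
        \<le> ennreal C1 * (ennreal (2 powr recip q) *
            (ennreal (2 powr \<gamma> * K * t powr \<delta>) * R + ennreal (L * K * C2 * t powr \<delta>) * R))"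
      by (rule order_trans[OF whole mult_left_mono[OF order_trans[OF split mult_left_mono[OF add_mono[OF left right]]]]])
        simp_all
    also have "\<dots> = ennreal (C1 * (2 powr recip q * (2 powr \<gamma> * K * t powr \<delta> + L * K * C2 * t powr \<delta>))) * R"
      using C1 K L C2(1) by (simp add: ennreal_mult distrib_left distrib_right ac_simps)
    also have "C1 * (2 powr recip q * (2 powr \<gamma> * K * t powr \<delta> + L * K * C2 * t powr \<delta>)) = ?C * t powr \<delta>"
      by (simp add: algebra_simps)
    finally show ?thesis unfolding R_def N_def .
  qed
  then show ?thesis using C1 K L C2(1) by (intro exI[of _ ?C]) (auto intro!: mult_pos_pos add_pos_pos)
qed

section \<open>Equivalence of the norms\<close>

text \<open>Valid on the whole line, since \<open>ennreal t\<close> is \<open>0\<close> for negative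
  \<open>t\<close>.\<close>

lemma antimono_rearr: "antimono (rearr f)"
proof (rule antimonoI)
  fix s t :: real assume "s \<le> t"
  then have "ennreal s \<le> ennreal t" by (rule ennreal_leI)
  then show "rearr f t \<le> rearr f s"
    unfolding rearr_def by (intro Inf_superset_mono) (auto intro: order_trans)
qed

text \<open>No sign is assumed for \<open>y\<close>, because \<open>d\<close> is unrestricted
  outside \<open>(0, 1)\<close> and the identities for the averages hold at every real
  point.\<close>

lemma weight_split:
  "ennreal (x powr (a - s) * y) * z = ennreal (x powr - s) * (ennreal (x powr a * y) * z)"
proof -
  have "x powr (a - s) * y = x powr - s * (x powr a * y)"
    using powr_add[of x "- s" a] by simp
  then have "ennreal (x powr (a - s) * y) = ennreal (x powr - s) * ennreal (x powr a * y)"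
    by (simp only: ennreal_mult'[of "x powr - s"] powr_ge_zero)
  then show ?thesis
    by (simp only: mult.assoc)
qed

section \<open>The functionals in terms of the invariant measure\<close>

lemma Bnorm_eq_Mnorm:
  "Bnorm b p q r g = Mnorm r 0 1 (\<lambda>t. ennreal (b t) * Mnorm q 0 t (\<lambda>u. ennreal (u powr (1 / p)) * g u))"
proof -
  have "ennreal (x powr (1 / p - recip q)) * g x = ennreal (x powr - recip q) * (ennreal (x powr (1 / p)) * g x)" for x
    using weight_split[of x "1 / p" "recip q" 1 "g x"] by simp
  then show ?thesis
    by (simp add: Bnorm_def Mnorm_def ennreal_mult' mult.assoc)
qed

lemma H_upper_eq_Hup: "H_upper U W d f = Hup (1 / U) W d (rearr f)"
  unfolding H_upper_def Hup_def Mnorm_def weight_split ..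

lemma H_lower_eq_Hlow: "H_lower V W d f = Hlow (recip V) W d (rearr f)"
  unfolding H_lower_def Hlow_def Mnorm_def weight_split ..

lemma measurable_Bnorm_integrand:
  assumes b: "b \<in> SV" and q: "0 < q" and k: "k \<in> borel_measurable (lebesgue_on {0<..<1})"
  shows "(\<lambda>t. ennreal (b t) * Mnorm q 0 t k) \<in> borel_measurable (lebesgue_on {0<..<1})"
proof -
  have "mono_on {0<..<1} (\<lambda>t. Mnorm q 0 t k)"
    unfolding monotone_on_def
  proof (intro ballI impI)
    fix s t :: real assume st: "s \<in> {0<..<1}" "t \<in> {0<..<1}" "s \<le> t"
    then have "k \<in> borel_measurable (lebesgue_on {0<..<s})"
      by (intro measurable_restrict_mono[OF k]) auto
    then show "Mnorm q 0 s k \<le> Mnorm q 0 t k"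
      using st by (intro Mnorm_le[OF q]) auto
  qed
  then have "(\<lambda>t. Mnorm q 0 t k) \<in> borel_measurable (lebesgue_on {0<..<1})"
    by (intro borel_measurable_lebesgue_on_monotone) simp
  moreover have "(\<lambda>t. ennreal (b t)) \<in> borel_measurable (lebesgue_on {0<..<1})"
    by (rule measurable_compose[OF SV_measurable[OF b] measurable_ennreal]) simp_all
  ultimately show ?thesis
    by (intro borel_measurable_times_ennreal)
qed

text \<open>A comparison of the inner norms over each \<open>(0, t)\<close>, uniform in
  \<open>t\<close>, passes through the outer norm whatever \<open>b\<close> and \<open>r\<close>
  are. Three of the four estimates below have this form; the upper bound for the lower average does
  not.\<close>

lemma Bnorm_le_cmult:
  assumes b: "b \<in> SV" and q: "0 < q" and r: "0 < r"
    and g: "g \<in> borel_measurable (lebesgue_on {0<..<1})" and h: "h \<in> borel_measurable (lebesgue_on {0<..<1})"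
    and le: "\<And>t. 0 < t \<Longrightarrow> t < 1 \<Longrightarrow> Mnorm q 0 t (\<lambda>u. ennreal (u powr (1 / p)) * g u)
      \<le> C * Mnorm q 0 t (\<lambda>u. ennreal (u powr (1 / p)) * h u)"
  shows "Bnorm b p q r g \<le> C * Bnorm b p q r h"
  unfolding Bnorm_eq_Mnorm
proof (rule Mnorm_le_cmult[OF r])
  fix t :: real assume t: "0 < t" "t < 1"
  have "ennreal (b t) * Mnorm q 0 t (\<lambda>u. ennreal (u powr (1 / p)) * g u)
      \<le> ennreal (b t) * (C * Mnorm q 0 t (\<lambda>u. ennreal (u powr (1 / p)) * h u))"
    using le[OF t] by (rule mult_left_mono) simp
  then show "ennreal (b t) * Mnorm q 0 t (\<lambda>u. ennreal (u powr (1 / p)) * g u)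
      \<le> C * (ennreal (b t) * Mnorm q 0 t (\<lambda>u. ennreal (u powr (1 / p)) * h u))"
    by (simp add: ac_simps)
qed (intro measurable_Bnorm_integrand b q measurable_weight g h)+

lemma equiv_onI:
  assumes C: "0 < C" and D: "0 < D"
    and FG: "\<And>x. x \<in> A \<Longrightarrow> F x \<le> ennreal C * G x"
    and GF: "\<And>x. x \<in> A \<Longrightarrow> G x \<le> ennreal D * F x"
  shows "equiv_on A F G"
  unfolding equiv_on_def
proof (intro exI conjI ballI)
  fix x assume x: "x \<in> A"
  have "ennreal (1 / D) * G x \<le> ennreal (1 / D) * (ennreal D * F x)"
    by (rule mult_left_mono[OF GF[OF x]]) simp
  also have "\<dots> = F x"
    using D by (simp add: mult.assoc[symmetric] ennreal_mult[symmetric])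
  finally show "ennreal (1 / D) * G x \<le> F x" .
  \<comment> \<open>The maximum secures the ordering of the two constants that
    \<open>equiv_on\<close> demands.\<close>
  show "F x \<le> ennreal (max C (1 / D)) * G x"
    using FG[OF x] by (rule order_trans) (intro mult_right_mono ennreal_leI, auto)
qed (use D in auto)

lemma borel_measurable_lebesgue_on_subinterval:
  fixes g :: "real \<Rightarrow> ennreal"
  assumes "g \<in> borel_measurable (lebesgue_on {0<..<1})" "0 \<le> l" "m \<le> 1"
  shows "g \<in> borel_measurable (lebesgue_on {l<..<m})"
  using assms by (intro measurable_restrict_mono[OF assms(1)]) auto

section \<open>The four one-sided estimates\<close>

lemma Bnorm_le_Hup:
  assumes b: "b \<in> SV" and d: "d \<in> SV" and q: "0 < q" and r: "0 < r" and W: "0 < W" and a: "0 \<le> a"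
  shows "\<exists>C>0. \<forall>h. antimono h \<longrightarrow> Bnorm b p q r h \<le> ennreal C * Bnorm b p q r (Hup a W d h)"
proof -
  obtain C where C: "0 < C"
    "\<And>h t. antimono h \<Longrightarrow> 0 < t \<Longrightarrow> t < 1 \<Longrightarrow> h t \<le> ennreal C * Hup a W d h t"
    using Hup_ge[OF d W a] by blast
  have "Bnorm b p q r h \<le> ennreal C * Bnorm b p q r (Hup a W d h)" if h: "antimono h" for h
  proof (rule Bnorm_le_cmult[OF b q r])
    have mh: "h \<in> borel_measurable borel"
      using h by (intro borel_measurable_monotone) simp
    note mH = measurable_Hup[OF d h W, of a]
    show "h \<in> borel_measurable (lebesgue_on {0<..<1})" "Hup a W d h \<in> borel_measurable (lebesgue_on {0<..<1})"
      using mh mH by (auto intro: borel_measurable_lebesgue_on)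
    fix t :: real assume t: "0 < t" "t < 1"
    show "Mnorm q 0 t (\<lambda>u. ennreal (u powr (1 / p)) * h u)
        \<le> ennreal C * Mnorm q 0 t (\<lambda>u. ennreal (u powr (1 / p)) * Hup a W d h u)"
    proof (rule Mnorm_le_cmult[OF q])
      fix u assume "0 < u" "u < t"
      then have "ennreal (u powr (1 / p)) * h u \<le> ennreal (u powr (1 / p)) * (ennreal C * Hup a W d h u)"
        using t by (intro mult_left_mono C(2) h) auto
      then show "ennreal (u powr (1 / p)) * h u \<le> ennreal C * (ennreal (u powr (1 / p)) * Hup a W d h u)"
        by (simp add: ac_simps)
    next
      show "(\<lambda>u. ennreal (u powr (1 / p)) * h u) \<in> borel_measurable (lebesgue_on {0<..<t})"
        by (rule measurable_weight[OF borel_measurable_lebesgue_on[OF mh]])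
      show "(\<lambda>u. ennreal (u powr (1 / p)) * Hup a W d h u) \<in> borel_measurable (lebesgue_on {0<..<t})"
        using t by (intro measurable_weight borel_measurable_lebesgue_on_subinterval[OF mH]) auto
    qed
  qed
  then show ?thesis using C(1) by blast
qed

lemma Bnorm_Hup_le:
  assumes b: "b \<in> SV" and d: "d \<in> SV" and q: "0 < q" and r: "0 < r" and W: "0 < W"
    and p: "0 < p" "1 / p < a"
  shows "\<exists>C>0. \<forall>h. antimono h \<longrightarrow> Bnorm b p q r (Hup a W d h) \<le> ennreal C * Bnorm b p q r h"
proof -
  \<comment> \<open>The midpoint leaves room on both sides: \<open>a - \<beta>\<close> is consumed
    in bounding the average pointwise, and \<open>\<beta> - 1 / p\<close> is the Hardy
    exponent.\<close>
  define \<beta> where "\<beta> = (1 / p + a) / 2"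
  define \<gamma> where "\<gamma> = \<beta> - 1 / p"
  have \<beta>: "0 \<le> \<beta>" "\<beta> < a" "0 < \<gamma>"
    using p by (auto simp: \<beta>_def \<gamma>_def field_simps intro!: add_nonneg_nonneg)
  obtain C where C: "0 < C"
    "\<And>h t. antimono h \<Longrightarrow> 0 < t \<Longrightarrow> t < 1 \<Longrightarrow>
      Hup a W d h t \<le> ennreal (C * t powr - \<beta>) * Mnorm q 0 t (\<lambda>x. ennreal (x powr \<beta>) * h x)"
    using Hup_le[OF d W q \<beta>(1,2)] by blast
  obtain D where D: "0 < D"
    "\<And>g t. g \<in> borel_measurable borel \<Longrightarrow>
      Mnorm q 0 t (\<lambda>u. ennreal (u powr - \<gamma>) * Mnorm q 0 u (\<lambda>x. ennreal (x powr \<gamma>) * g x)) \<le> ennreal D * Mnorm q 0 t g"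
    using Hardy_lower_limit_0[OF q \<beta>(3)] by blast
  have "Bnorm b p q r (Hup a W d h) \<le> ennreal (C * D) * Bnorm b p q r h" if h: "antimono h" for h
  proof (rule Bnorm_le_cmult[OF b q r])
    have mh [measurable]: "h \<in> borel_measurable borel"
      using h by (intro borel_measurable_monotone) simp
    note mH = measurable_Hup[OF d h W, of a]
    show "h \<in> borel_measurable (lebesgue_on {0<..<1})" "Hup a W d h \<in> borel_measurable (lebesgue_on {0<..<1})"
      using mh mH by (auto intro: borel_measurable_lebesgue_on)
    fix t :: real assume t: "0 < t" "t < 1"
    let ?g = "\<lambda>x. ennreal (x powr (1 / p)) * h x"
    let ?M = "\<lambda>u. Mnorm q 0 u (\<lambda>x. ennreal (x powr \<gamma>) * ?g x)"
    have eq: "(\<lambda>x. ennreal (x powr \<beta>) * h x) = (\<lambda>x. ennreal (x powr \<gamma>) * ?g x)"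
      by (simp add: \<gamma>_def powr_diff fun_eq_iff mult.assoc[symmetric] ennreal_mult[symmetric])
    have "mono ?M"
      by (auto simp: mono_def intro!: Mnorm_subinterval q)
    then have [measurable]: "?M \<in> borel_measurable borel"
      by (intro borel_measurable_monotone) simp
    have "Mnorm q 0 t (\<lambda>u. ennreal (u powr (1 / p)) * Hup a W d h u)
        \<le> ennreal C * Mnorm q 0 t (\<lambda>u. ennreal (u powr - \<gamma>) * ?M u)"
    proof (rule Mnorm_le_cmult[OF q])
      fix u assume u: "0 < u" "u < t"
      then have "ennreal (u powr (1 / p)) * Hup a W d h u
          \<le> ennreal (u powr (1 / p)) * (ennreal (C * u powr - \<beta>) * ?M u)"
        using t C(2)[OF h, of u] by (intro mult_left_mono) (auto simp: eq)
      also have "\<dots> = ennreal (C * (u powr (1 / p) * u powr - \<beta>)) * ?M u"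
        using C(1) by (simp add: ennreal_mult ac_simps)
      also have "u powr (1 / p) * u powr - \<beta> = u powr - \<gamma>"
        by (simp add: \<gamma>_def powr_add[symmetric])
      finally show "ennreal (u powr (1 / p)) * Hup a W d h u \<le> ennreal C * (ennreal (u powr - \<gamma>) * ?M u)"
        using C(1) by (simp add: ennreal_mult mult.assoc)
    next
      show "(\<lambda>u. ennreal (u powr (1 / p)) * Hup a W d h u) \<in> borel_measurable (lebesgue_on {0<..<t})"
        using t by (intro measurable_weight borel_measurable_lebesgue_on_subinterval[OF mH]) auto
      show "(\<lambda>u. ennreal (u powr - \<gamma>) * ?M u) \<in> borel_measurable (lebesgue_on {0<..<t})"
        by (rule borel_measurable_lebesgue_on) measurable
    qed
    also have "\<dots> \<le> ennreal C * (ennreal D * Mnorm q 0 t ?g)"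
      by (intro mult_left_mono D(2)) simp_all
    finally show "Mnorm q 0 t (\<lambda>u. ennreal (u powr (1 / p)) * Hup a W d h u) \<le> ennreal (C * D) * Mnorm q 0 t ?g"
      using C(1) D(1) by (simp add: ennreal_mult mult.assoc)
  qed
  then show ?thesis using C(1) D(1) by (intro exI[of _ "C * D"]) auto
qed

lemma Bnorm_le_Hlow:
  assumes b: "b \<in> SV" and d: "d \<in> SV" and q: "0 < q" and r: "0 < r" and W: "0 < W" and a: "0 \<le> a"
  shows "\<exists>C>0. \<forall>h. antimono h \<longrightarrow> Bnorm b p q r h \<le> ennreal C * Bnorm b p q r (Hlow a W d h)"
proof -
  obtain C where C: "0 < C"
    "\<And>h t. antimono h \<Longrightarrow> 0 < t \<Longrightarrow> t < 1 \<Longrightarrow> h t \<le> ennreal C * Hlow a W d h (t / 2)"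
    using Hlow_ge[OF d W a] by blast
  have "Bnorm b p q r h \<le> ennreal (2 powr (1 / p) * C) * Bnorm b p q r (Hlow a W d h)" if h: "antimono h" for h
  proof (rule Bnorm_le_cmult[OF b q r])
    have mh [measurable]: "h \<in> borel_measurable borel"
      using h by (intro borel_measurable_monotone) simp
    note mH = measurable_Hlow[OF d h W, of a]
    show "h \<in> borel_measurable (lebesgue_on {0<..<1})" "Hlow a W d h \<in> borel_measurable (lebesgue_on {0<..<1})"
      using mh mH by (auto intro: borel_measurable_lebesgue_on)
    fix t :: real assume t: "0 < t" "t < 1"
    have mHt: "(\<lambda>u. ennreal (u powr (1 / p)) * Hlow a W d h u) \<in> borel_measurable (lebesgue_on {0<..<s})" if "s \<le> 1" for s
      using that by (intro measurable_weight borel_measurable_lebesgue_on_subinterval[OF mH]) auto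
    \<comment> \<open>The pointwise bound evaluates the average at half the argument of
      \<open>h\<close>, so the variable is doubled first.\<close>
    have "Mnorm q 0 t (\<lambda>u. ennreal (u powr (1 / p)) * h u)
        \<le> Mnorm q 0 (t / 2) (\<lambda>u. ennreal ((2 * u) powr (1 / p)) * h (2 * u))"
      using Mnorm_dilate_le[OF q, of "\<lambda>u. ennreal ((2 * u) powr (1 / p)) * h (2 * u)" t] by simp
    also have "\<dots> \<le> ennreal (2 powr (1 / p) * C) * Mnorm q 0 (t / 2) (\<lambda>u. ennreal (u powr (1 / p)) * Hlow a W d h u)"
    proof (rule Mnorm_le_cmult[OF q])
      fix u assume u: "0 < u" "u < t / 2"
      then have "ennreal ((2 * u) powr (1 / p)) * h (2 * u) \<le> ennreal ((2 * u) powr (1 / p)) * (ennreal C * Hlow a W d h u)"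
        using t C(2)[OF h, of "2 * u"] by (intro mult_left_mono) auto
      then show "ennreal ((2 * u) powr (1 / p)) * h (2 * u)
          \<le> ennreal (2 powr (1 / p) * C) * (ennreal (u powr (1 / p)) * Hlow a W d h u)"
        using C(1) u by (simp add: powr_mult ennreal_mult ac_simps)
    qed (use t in \<open>auto intro: mHt borel_measurable_lebesgue_on\<close>)
    also have "\<dots> \<le> ennreal (2 powr (1 / p) * C) * Mnorm q 0 t (\<lambda>u. ennreal (u powr (1 / p)) * Hlow a W d h u)"
      using t by (intro mult_left_mono Mnorm_le[OF q] mHt) auto
    finally show "Mnorm q 0 t (\<lambda>u. ennreal (u powr (1 / p)) * h u)
        \<le> ennreal (2 powr (1 / p) * C) * Mnorm q 0 t (\<lambda>u. ennreal (u powr (1 / p)) * Hlow a W d h u)" .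
  qed
  then show ?thesis using C(1) by (intro exI[of _ "2 powr (1 / p) * C"]) auto
qed

text \<open>The average at \<open>u\<close> involves \<open>h\<close> on all of
  \<open>(u, 1)\<close>, so the outer norm has to take part: the inner norm is bounded by
  \<open>t powr \<delta>\<close> times an \<open>r\<close>-norm over \<open>(t / 2, 1)\<close>, and
  that factor \<open>t powr \<delta>\<close> drives a Hardy inequality for the outer
  \<open>r\<close>-norm.\<close>

lemma Bnorm_Hlow_le:
  assumes b: "b \<in> SV" and d: "d \<in> SV" and q: "0 < q" and r: "0 < r" and W: "0 < W"
    and p: "0 < p" "0 \<le> a" "a < 1 / p"
  shows "\<exists>C>0. \<forall>h. antimono h \<longrightarrow> Bnorm b p q r (Hlow a W d h) \<le> ennreal C * Bnorm b p q r h"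
proof -
  \<comment> \<open>Of the gap between \<open>a\<close> and \<open>1 / p\<close>, half goes to the
    pointwise bound and half is \<open>\<gamma>\<close>. Then \<open>\<delta> < \<gamma>\<close> is
    the power gained in \<open>t\<close>, and its halves \<open>\<epsilon>\<close> serve the
    variation of \<open>b\<close> and the convergence of the outer Hardy inequality.\<close>
  define \<beta> where "\<beta> = (1 / p + a) / 2"
  define \<gamma> where "\<gamma> = 1 / p - \<beta>"
  define \<delta> where "\<delta> = \<gamma> / 2"
  define \<epsilon> where "\<epsilon> = \<delta> / 2"
  have \<beta>: "0 \<le> \<beta>" "a < \<beta>" "0 < \<gamma>"
    using p by (auto simp: \<beta>_def \<gamma>_def field_simps intro!: add_nonneg_nonneg)
  have \<delta>: "0 < \<delta>" "\<delta> < \<gamma>" "\<gamma> \<le> 1 / p" "0 < \<epsilon>" "\<epsilon> + \<epsilon> = \<delta>" "0 \<le> 1 / p" "\<beta> = 1 / p - \<gamma>"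
    using \<beta> p by (auto simp: \<delta>_def \<epsilon>_def \<gamma>_def)
  obtain C1 where C1: "0 < C1"
    "\<And>h t. antimono h \<Longrightarrow> 0 < t \<Longrightarrow> t < 1 \<Longrightarrow>
      Hlow a W d h t \<le> ennreal (C1 * t powr - \<beta>) * Mnorm q (t / 2) 1 (\<lambda>x. ennreal (x powr \<beta>) * h x)"
    using Hlow_le[OF d W q \<beta>(1,2)] by blast
  obtain C2 where C2: "0 < C2"
    "\<And>h t. antimono h \<Longrightarrow> 0 < t \<Longrightarrow> t < 1 \<Longrightarrow>
      Mnorm q 0 t (\<lambda>u. ennreal (u powr \<gamma>) * Mnorm q (u / 2) 1 (\<lambda>x. ennreal (x powr (1 / p - \<gamma>)) * h x))
      \<le> ennreal (C2 * t powr \<delta>) *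
        Mnorm r (t / 2) 1 (\<lambda>y. ennreal (y powr - \<delta>) * Mnorm q 0 y (\<lambda>x. ennreal (x powr (1 / p)) * h x))"
    using inner_lower_average_le[OF q r \<delta>(6,1,2,3)] by blast
  obtain b' c C where b': "b' \<in> borel_measurable borel" "\<And>t. 0 \<le> b' t" "0 < c" "0 < C"
    "\<And>t. 0 < t \<Longrightarrow> t < 1 \<Longrightarrow> c * b' t \<le> b t \<and> b t \<le> C * b' t"
    using SV_equivalent_borel[OF b] by blast
  note [measurable] = b'(1)
  obtain C3 where C3: "0 < C3"
    "\<And>s t. 0 < s \<Longrightarrow> s \<le> t \<Longrightarrow> t < 1 \<Longrightarrow> s powr \<epsilon> * b s \<le> C3 * (t powr \<epsilon> * b t)"
    using SV_almost_increasing[OF b \<delta>(4)] by blast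
  obtain C4 where C4: "0 < C4"
    "\<And>s t. 0 < s \<Longrightarrow> s \<le> t \<Longrightarrow> t < 1 \<Longrightarrow> t powr - \<epsilon> * b t \<le> C4 * (s powr - \<epsilon> * b s)"
    using SV_almost_decreasing[OF b \<delta>(4)] by blast
  \<comment> \<open>\<open>C3\<close> covers \<open>u \<le> x\<close>,
    \<open>C4 * 2 powr (2 * \<epsilon>)\<close> covers \<open>x < u < 2 * x\<close>, and
    \<open>C / c\<close> converts between \<open>b\<close> and \<open>b'\<close>.\<close>
  define A where "A = (C3 + C4 * 2 powr (2 * \<epsilon>)) * C / c"
  have A: "0 < A" using C3(1) C4(1) b'(3,4) by (simp add: A_def add_pos_pos)
  have A_le: "u powr \<epsilon> * b' u \<le> A * (x powr \<epsilon> * b' x)"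
    if u: "0 < u" "u < 1" and x: "0 < x" "x < 1" and ux: "u < 2 * x" for u x
  proof -
    have bx: "0 < b x" using SV_pos[OF b] x by simp
    have "u powr \<epsilon> * b u \<le> (C3 + C4 * 2 powr (2 * \<epsilon>)) * (x powr \<epsilon> * b x)"
    proof (cases "u \<le> x")
      case True
      have "u powr \<epsilon> * b u \<le> C3 * (x powr \<epsilon> * b x)"
        using C3(2)[of u x] True u x by simp
      also have "\<dots> \<le> (C3 + C4 * 2 powr (2 * \<epsilon>)) * (x powr \<epsilon> * b x)"
        using C4(1) bx by (intro mult_right_mono) auto
      finally show ?thesis .
    next
      case False
      \<comment> \<open>Since \<open>u\<close> may exceed \<open>x\<close> here, the decreasing form
        of slow variation is used; the surplus power costs only a constant, as
        \<open>u < 2 * x\<close>.\<close>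
      have "u powr \<epsilon> * b u = u powr (2 * \<epsilon>) * (u powr - \<epsilon> * b u)"
        by (simp add: mult.assoc[symmetric] powr_add[symmetric])
      also have "\<dots> \<le> (2 * x) powr (2 * \<epsilon>) * (C4 * (x powr - \<epsilon> * b x))"
        using False u x ux \<delta>(4) SV_pos[OF b, of u] by (intro mult_mono[OF _ C4(2)] powr_mono2) auto
      also have "\<dots> = C4 * 2 powr (2 * \<epsilon>) * (x powr (2 * \<epsilon>) * x powr - \<epsilon> * b x)"
        using x by (simp add: powr_mult)
      also have "\<dots> = C4 * 2 powr (2 * \<epsilon>) * (x powr \<epsilon> * b x)"
        by (simp add: powr_add[symmetric])
      also have "\<dots> \<le> (C3 + C4 * 2 powr (2 * \<epsilon>)) * (x powr \<epsilon> * b x)"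
        using C3(1) bx by (intro mult_right_mono) auto
      finally show ?thesis .
    qed
    also have "\<dots> \<le> (C3 + C4 * 2 powr (2 * \<epsilon>)) * (x powr \<epsilon> * (C * b' x))"
      using b'(5)[of x] x C3(1) C4(1) by (intro mult_left_mono) auto
    finally have "u powr \<epsilon> * b u \<le> c * (A * (x powr \<epsilon> * b' x))"
      using b'(3) by (simp add: A_def ac_simps)
    moreover have "c * (u powr \<epsilon> * b' u) \<le> u powr \<epsilon> * b u"
      using b'(5)[of u] u by (simp add: mult.left_commute mult_left_mono)
    ultimately have "c * (u powr \<epsilon> * b' u) \<le> c * (A * (x powr \<epsilon> * b' x))"
      by (rule order_trans[rotated])
    then show ?thesis
      using b'(3) by simp
  qed
  show ?thesis
  proof (rule Hardy_upper_limit_1[OF r \<delta>(4)], goal_cases)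
    case (1 C5)
    note C5 = 1(1) and Hardy = 1(2)
    let ?K = "C * C1 * C2 * (A * C5) * (2 powr \<epsilon> / c)"
    have "Bnorm b p q r (Hlow a W d h) \<le> ennreal ?K * Bnorm b p q r h" if h: "antimono h" for h
    proof -
      have mh [measurable]: "h \<in> borel_measurable borel"
        using h by (intro borel_measurable_monotone) simp
      note mH = measurable_Hlow[OF d h W, of a]
      define N where "N y = Mnorm q 0 y (\<lambda>x. ennreal (x powr (1 / p)) * h x)" for y
      define k where "k y = ennreal (y powr - \<delta>) * N y" for y
      define R where "R t = Mnorm r (t / 2) 1 k" for t
      define M where "M u = Mnorm q (u / 2) 1 (\<lambda>x. ennreal (x powr \<beta>) * h x)" for u
      have "mono N"
        by (auto simp: mono_def N_def intro!: Mnorm_subinterval q)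
      then have [measurable]: "N \<in> borel_measurable borel"
        by (intro borel_measurable_monotone) simp
      have [measurable]: "k \<in> borel_measurable borel"
        unfolding k_def by measurable
      have "antimono R" "antimono M"
        by (auto simp: antimono_def R_def M_def intro!: Mnorm_subinterval q r)
      then have [measurable]: "R \<in> borel_measurable borel" "M \<in> borel_measurable borel"
        by (auto intro!: borel_measurable_monotone)
      have inner: "Mnorm q 0 t (\<lambda>u. ennreal (u powr (1 / p)) * Hlow a W d h u) \<le> ennreal (C1 * C2 * t powr \<delta>) * R t"
        if t: "0 < t" "t < 1" for t
      proof -
        have "Mnorm q 0 t (\<lambda>u. ennreal (u powr (1 / p)) * Hlow a W d h u)
            \<le> ennreal C1 * Mnorm q 0 t (\<lambda>u. ennreal (u powr \<gamma>) * M u)"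
        proof (rule Mnorm_le_cmult[OF q])
          fix u assume u: "0 < u" "u < t"
          then have "ennreal (u powr (1 / p)) * Hlow a W d h u
              \<le> ennreal (u powr (1 / p)) * (ennreal (C1 * u powr - \<beta>) * M u)"
            unfolding M_def using t C1(2)[OF h, of u] by (intro mult_left_mono) auto
          also have "\<dots> = ennreal (C1 * (u powr (1 / p) * u powr - \<beta>)) * M u"
            using C1(1) by (simp add: ennreal_mult ac_simps)
          also have "u powr (1 / p) * u powr - \<beta> = u powr \<gamma>"
            by (simp add: \<gamma>_def powr_add[symmetric])
          finally show "ennreal (u powr (1 / p)) * Hlow a W d h u \<le> ennreal C1 * (ennreal (u powr \<gamma>) * M u)"
            using C1(1) by (simp add: ennreal_mult mult.assoc)
        next
          show "(\<lambda>u. ennreal (u powr (1 / p)) * Hlow a W d h u) \<in> borel_measurable (lebesgue_on {0<..<t})"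
            using t by (intro measurable_weight borel_measurable_lebesgue_on_subinterval[OF mH]) auto
          show "(\<lambda>u. ennreal (u powr \<gamma>) * M u) \<in> borel_measurable (lebesgue_on {0<..<t})"
            by (rule borel_measurable_lebesgue_on) measurable
        qed
        also have "\<dots> \<le> ennreal C1 * (ennreal (C2 * t powr \<delta>) * R t)"
          using C2(2)[OF h t] by (intro mult_left_mono) (simp_all add: M_def R_def k_def[abs_def] N_def \<delta>(7))
        finally show ?thesis
          using C1(1) C2(1) by (simp add: ennreal_mult mult.assoc)
      qed
      have "Bnorm b p q r (Hlow a W d h)
          \<le> ennreal (C * C1 * C2) * Mnorm r 0 1 (\<lambda>t. ennreal (t powr \<delta> * b' t) * R t)"
        unfolding Bnorm_eq_Mnorm
      proof (rule Mnorm_le_cmult[OF r])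
        fix t :: real assume t: "0 < t" "t < 1"
        have "ennreal (b t) * Mnorm q 0 t (\<lambda>u. ennreal (u powr (1 / p)) * Hlow a W d h u)
            \<le> ennreal (C * b' t) * (ennreal (C1 * C2 * t powr \<delta>) * R t)"
          using b'(5)[OF t] by (intro mult_mono inner[OF t] ennreal_leI) auto
        then show "ennreal (b t) * Mnorm q 0 t (\<lambda>u. ennreal (u powr (1 / p)) * Hlow a W d h u)
            \<le> ennreal (C * C1 * C2) * (ennreal (t powr \<delta> * b' t) * R t)"
          using C1(1) C2(1) b'(2)[of t] b'(4) by (simp add: ennreal_mult ac_simps)
      next
        show "(\<lambda>t. ennreal (b t) * Mnorm q 0 t (\<lambda>u. ennreal (u powr (1 / p)) * Hlow a W d h u))
            \<in> borel_measurable (lebesgue_on {0<..<1})"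
          by (intro measurable_Bnorm_integrand b q measurable_weight mH)
        show "(\<lambda>t. ennreal (t powr \<delta> * b' t) * R t) \<in> borel_measurable (lebesgue_on {0<..<1})"
          by (rule borel_measurable_lebesgue_on) measurable
      qed
      \<comment> \<open>Hardy's inequality with exponent \<open>r\<close>, \<open>T = 1\<close> and
        \<open>\<phi> x = x powr \<epsilon> * b' x\<close>: one half of
        \<open>u powr \<delta>\<close> stays with \<open>b'\<close>, the other is the required
        \<open>u powr \<eta>\<close>.\<close>
      also have "\<dots> \<le> ennreal (C * C1 * C2) * (ennreal (A * C5) *
          Mnorm r 0 1 (\<lambda>x. ennreal (min 1 (2 * x) powr \<epsilon> * (x powr \<epsilon> * b' x)) * k x))"
        unfolding R_def
      proof (intro mult_left_mono Hardy)
        fix u x :: real assume ux: "0 < u" "u < 1" "0 < x" "x < 1" "u < 2 * x"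
        have "u powr \<delta> * b' u = (u powr \<epsilon> * b' u) * u powr \<epsilon>"
          by (simp only: \<delta>(5)[symmetric] powr_add ac_simps)
        also have "\<dots> \<le> A * (x powr \<epsilon> * b' x) * u powr \<epsilon>"
          using ux by (intro mult_right_mono A_le) auto
        finally show "u powr \<delta> * b' u \<le> A * (x powr \<epsilon> * b' x) * u powr \<epsilon>" .
      qed (use A b'(2) in auto)
      \<comment> \<open>The minimum contributes \<open>x powr \<epsilon>\<close>,
        \<open>\<phi>\<close> contributes another, and together they cancel the
        \<open>x powr - \<delta>\<close> inside \<open>k\<close>. What remains is
        \<open>b' x * N x\<close>, and \<open>c * b' x \<le> b x\<close> leads back to the norm of
        \<open>h\<close>.\<close>
      also have "\<dots> \<le> ennreal (C * C1 * C2) * (ennreal (A * C5) * (ennreal (2 powr \<epsilon> / c) * Bnorm b p q r h))"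
        unfolding Bnorm_eq_Mnorm
      proof (intro mult_left_mono Mnorm_le_cmult[OF r])
        fix x :: real assume x: "0 < x" "x < 1"
        have "min 1 (2 * x) powr \<epsilon> \<le> (2 * x) powr \<epsilon>"
          using x \<delta>(4) by (intro powr_mono2) auto
        then have "min 1 (2 * x) powr \<epsilon> * (x powr \<epsilon> * b' x) * x powr - \<delta>
            \<le> (2 * x) powr \<epsilon> * (x powr \<epsilon> * b' x) * x powr - \<delta>"
          using b'(2)[of x] by (intro mult_right_mono) auto
        also have "\<dots> = 2 powr \<epsilon> * b' x * (x powr \<epsilon> * x powr \<epsilon> * x powr - \<delta>)"
          using x by (simp add: powr_mult)
        also have "x powr \<epsilon> * x powr \<epsilon> * x powr - \<delta> = 1"
          using x by (simp add: powr_add[symmetric] \<delta>(5))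
        also have "2 powr \<epsilon> * b' x * 1 \<le> 2 powr \<epsilon> / c * b x"
          using b'(5)[OF x] b'(3) by (simp add: field_simps)
        finally have "ennreal (min 1 (2 * x) powr \<epsilon> * (x powr \<epsilon> * b' x) * x powr - \<delta>) * N x
            \<le> ennreal (2 powr \<epsilon> / c * b x) * N x"
          by (intro mult_right_mono ennreal_leI) auto
        moreover have "ennreal (min 1 (2 * x) powr \<epsilon> * (x powr \<epsilon> * b' x) * x powr - \<delta>) * N x
            = ennreal (min 1 (2 * x) powr \<epsilon> * (x powr \<epsilon> * b' x)) * k x"
          unfolding k_def using b'(2)[of x] by (simp add: ennreal_mult mult.assoc)
        moreover have "ennreal (2 powr \<epsilon> / c * b x) = ennreal (2 powr \<epsilon> / c) * ennreal (b x)"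
          using b'(3) by (intro ennreal_mult') simp
        ultimately show "ennreal (min 1 (2 * x) powr \<epsilon> * (x powr \<epsilon> * b' x)) * k x \<le> ennreal (2 powr \<epsilon> / c) *
            (ennreal (b x) * Mnorm q 0 x (\<lambda>u. ennreal (u powr (1 / p)) * h u))"
          by (simp add: N_def mult.assoc)
      next
        show "(\<lambda>x. ennreal (min 1 (2 * x) powr \<epsilon> * (x powr \<epsilon> * b' x)) * k x) \<in> borel_measurable (lebesgue_on {0<..<1})"
          by (rule borel_measurable_lebesgue_on) measurable
        show "(\<lambda>t. ennreal (b t) * Mnorm q 0 t (\<lambda>u. ennreal (u powr (1 / p)) * h u))
            \<in> borel_measurable (lebesgue_on {0<..<1})"
          by (intro measurable_Bnorm_integrand b q measurable_weight borel_measurable_lebesgue_on mh)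
      qed auto
      also have "\<dots> = ennreal ?K * Bnorm b p q r h"
        using C1(1) C2(1) C5 A b'(3,4)
        by (simp add: ennreal_mult mult.assoc del: times_divide_eq_left times_divide_eq_right)
      finally show ?thesis .
    qed
    moreover have "0 < ?K"
      using C1(1) C2(1) C5 A b'(3,4) by simp
    ultimately show ?case by blast
  qed
qed

theorem theorem53:
  fixes p U :: real and q r V W :: ennreal and b d :: "real \<Rightarrow> real"
  assumes "0 < p" and "0 < q" and "0 < r"
    and "b \<in> SV"
    and "Lnorm r 0 1 (\<lambda>t. ennreal (t powr (- recip r) * b t)) = \<infinity>"
    and "d \<in> SV"
    and "0 < U" and "0 < V" and "0 < W"
  shows "(U < p \<longrightarrow>
           equiv_on Mfun (small_Lorentz_norm b p q r) (\<lambda>f. Bnorm b p q r (H_upper U W d f))) \<and>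
         (ennreal p < V \<longrightarrow>
           equiv_on Mfun (small_Lorentz_norm b p q r) (\<lambda>f. Bnorm b p q r (H_lower V W d f)))"
proof (intro conjI impI)
  note q = assms(2) and r = assms(3) and b = assms(4) and d = assms(6) and W = assms(9)
  assume "U < p"
  then have U: "0 \<le> 1 / U" "1 / p < 1 / U"
    using assms(7) by (simp_all add: frac_less2)
  obtain C where "0 < C" "\<And>h. antimono h \<Longrightarrow> Bnorm b p q r h \<le> ennreal C * Bnorm b p q r (Hup (1 / U) W d h)"
    using Bnorm_le_Hup[OF b d q r W U(1)] by blast
  moreover obtain D where "0 < D" "\<And>h. antimono h \<Longrightarrow> Bnorm b p q r (Hup (1 / U) W d h) \<le> ennreal D * Bnorm b p q r h"
    using Bnorm_Hup_le[OF b d q r W assms(1) U(2)] by blast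
  ultimately show "equiv_on Mfun (small_Lorentz_norm b p q r) (\<lambda>f. Bnorm b p q r (H_upper U W d f))"
    by (intro equiv_onI[of C D]) (simp_all add: small_Lorentz_norm_def H_upper_eq_Hup antimono_rearr)
next
  note q = assms(2) and r = assms(3) and b = assms(4) and d = assms(6) and W = assms(9)
  assume V: "ennreal p < V"
  \<comment> \<open>With \<open>V = \<infinity>\<close> the reciprocal is \<open>0\<close>, so the
    condition reduces to \<open>0 < 1 / p\<close>.\<close>
  have rV: "recip V < 1 / p"
  proof (cases "V = top")
    case False
    then have "p < enn2real V"
      using V assms(1) by (cases V) (auto simp: ennreal_less_iff)
    then show ?thesis
      using assms(1) by (simp add: recip_finite[OF False] frac_less2)
  qed (use assms(1) in simp)
  obtain C where "0 < C" "\<And>h. antimono h \<Longrightarrow> Bnorm b p q r h \<le> ennreal C * Bnorm b p q r (Hlow (recip V) W d h)"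
    using Bnorm_le_Hlow[OF b d q r W recip_nonneg] by blast
  moreover obtain D where "0 < D" "\<And>h. antimono h \<Longrightarrow> Bnorm b p q r (Hlow (recip V) W d h) \<le> ennreal D * Bnorm b p q r h"
    using Bnorm_Hlow_le[OF b d q r W assms(1) recip_nonneg rV] by blast
  ultimately show "equiv_on Mfun (small_Lorentz_norm b p q r) (\<lambda>f. Bnorm b p q r (H_lower V W d f))"
    by (intro equiv_onI[of C D]) (simp_all add: small_Lorentz_norm_def H_lower_eq_Hlow antimono_rearr)
qed

end
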